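(* Let $n,N\ge 2$ and $k$ be integers with $2\le k\le\min\{n,N\}$, and let $1\le p<k$. Suppose $f\colon\mathbb{R}^{N\times n}\to\mathbb{R}$ is continuous, bounded below and $W^{1,p}$-quasiconvex. If for some $\gamma\ge 0$ one has $f(\xi)\le\gamma$ for all $\xi\in\mathbb{R}^{N\times n}$ with $\operatorname{rank}(\xi)\le k-1$, then $f(\xi)\le\gamma$ (with the same constant $\gamma$) for all $\xi\in\mathbb{R}^{N\times n}$. In particular, if $f$ is non-negative and $f(\xi)=0$ whenever $\operatorname{rank}(\xi)\le k-1$, then $f$ is identically zero on $\mathbb{R}^{N\times n}$.
   Context: $\mathbb{R}^{N\times n}$ is the space of real $N\times n$ matrices and $\mathscr{L}^n$ is Lebesgue measure on $\mathbb{R}^n$. Definition ($W^{1,p}$-quasiconvexity). Let $f\colon\mathbb{R}^{N\times n}\to\mathbb{R}\cup\{+\infty\}$ be Borel measurable and bounded below, and let $1\le p\le\infty$. $f$ is $W^{1,p}$-quasiconvex at $\xi\in\mathbb{R}^{N\times n}$ if for some nonempty bounded open set $\Omega\subset\mathbb{R}^n$ with $\mathscr{L}^n(\partial\Omega)=0$ one has $$\int_\Omega f(\xi+\nabla\phi(x))\,dx\ \ge\ \mathscr{L}^n(\Omega)\,f(\xi)\qquad\text{for all }\phi\in W^{1,p}_0(\Omega;\mathbb{R}^N).$$ $f$ is $W^{1,p}$-quasiconvex if this holds at every $\xi\in\mathbb{R}^{N\times n}$. (If the inequality holds for one such set $\Omega$, it holds for all bounded open sets $D\subset\mathbb{R}^n$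 with $\mathscr{L}^n(\partial D)=0$.) *)

theory Defs
  imports "HOL-Analysis.Analysis"
begin

text \<open>Matrices with rows indexed by \<open>'m\<close> and columns by \<open>'n\<close> have type \<open>real^'n^'m\<close>; the norm of this
  type is the Frobenius norm. The gradient of a map from \<open>real^'n\<close> to \<open>real^'m\<close> is its Jacobian
  matrix, with entry \<open>(i, j)\<close> the \<open>j\<close>-th partial derivative of the \<open>i\<close>-th component.\<close>

text \<open>For a finite-dimensional domain this is the usual class of \<open>k\<close> times continuously differentiable
  functions: continuity of all the directional derivatives gives continuity of the derivative as a
  linear map.\<close>

primrec Ck :: "nat \<Rightarrow> ('a::euclidean_space \<Rightarrow> 'b::real_normed_vector) \<Rightarrow> bool" where
  "Ck 0 f \<longleftrightarrow> continuous_on UNIV f"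
| "Ck (Suc k) f \<longleftrightarrow> (\<forall>x. f differentiable (at x)) \<and>
     (\<forall>v. Ck k (\<lambda>x. frechet_derivative f (at x) v))"

definition test_functions :: "'a::euclidean_space set \<Rightarrow> ('a \<Rightarrow> 'b::real_normed_vector) set" where
  "test_functions \<Omega> = {\<phi>. (\<forall>k. Ck k \<phi>) \<and> compact (closure {x. \<phi> x \<noteq> 0}) \<and> closure {x. \<phi> x \<noteq> 0} \<subseteq> \<Omega>}"

definition Lp_space :: "real \<Rightarrow> 'a::euclidean_space set \<Rightarrow> ('a \<Rightarrow> 'b::euclidean_space) set" where
  "Lp_space p \<Omega> = {u. u \<in> borel_measurable (lebesgue_on \<Omega>) \<and>
     integrable (lebesgue_on \<Omega>) (\<lambda>x. norm (u x) powr p)}"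

definition locally_integrable_on :: "('a::euclidean_space \<Rightarrow> 'b::euclidean_space) \<Rightarrow> 'a set \<Rightarrow> bool" where
  "locally_integrable_on u \<Omega> \<longleftrightarrow> (\<forall>K. compact K \<and> K \<subseteq> \<Omega> \<longrightarrow> integrable (lebesgue_on K) u)"

definition has_weak_gradient ::
    "(real^'n \<Rightarrow> real^'m) \<Rightarrow> (real^'n \<Rightarrow> real^'n^'m) \<Rightarrow> (real^'n) set \<Rightarrow> bool" where
  "has_weak_gradient u G \<Omega> \<longleftrightarrow> locally_integrable_on u \<Omega> \<and> locally_integrable_on G \<Omega> \<and>
     (\<forall>\<psi> \<in> test_functions \<Omega>. \<forall>i j.
        (\<integral>x. u x $ i * frechet_derivative \<psi> (at x) (axis j 1) \<partial>lebesgue_on \<Omega>)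
          = - (\<integral>x. G x $ i $ j * \<psi> x \<partial>lebesgue_on \<Omega>))"

text \<open>The closure of the test functions in the Sobolev space of exponent \<open>p\<close>, for \<open>1 \<le> p < \<infinity>\<close>.
  Elements are functions, not classes modulo equality almost everywhere, and their values
  outside \<open>\<Omega>\<close> are irrelevant.\<close>

definition sobolev0 :: "real \<Rightarrow> (real^'n) set \<Rightarrow> (real^'n \<Rightarrow> real^'m) set" where
  "sobolev0 p \<Omega> = {u. \<exists>G. u \<in> Lp_space p \<Omega> \<and> G \<in> Lp_space p \<Omega> \<and> has_weak_gradient u G \<Omega> \<and>
     (\<exists>\<phi>. (\<forall>k::nat. \<phi> k \<in> test_functions \<Omega>) \<and>
        (\<lambda>k. \<integral>x. norm (\<phi> k x - u x) powr p \<partial>lebesgue_on \<Omega>) \<longlonglongrightarrow> 0 \<and>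
        (\<lambda>k. \<integral>x. norm (jacobian (\<phi> k) (at x) - G x) powr p \<partial>lebesgue_on \<Omega>) \<longlonglongrightarrow> 0)}"

text \<open>Integral of the positive part minus integral of the negative part (\<open>e2ennreal\<close> sends negative
  values to \<open>0\<close>). The negative part has finite integral whenever \<open>g\<close> is bounded below by a real
  constant and \<open>M\<close> is finite, so \<open>\<infinity> - \<infinity>\<close> does not arise below.\<close>

definition extended_integral :: "'a measure \<Rightarrow> ('a \<Rightarrow> ereal) \<Rightarrow> ereal" where
  "extended_integral M g =
     enn2ereal (\<integral>\<^sup>+x. e2ennreal (g x) \<partial>M) - enn2ereal (\<integral>\<^sup>+x. e2ennreal (- g x) \<partial>M)"

text \<open>To be used for Borel measurable integrands that are bounded below by a real constant. Since
  weak gradients are determined only almost everywhere, \<open>G\<close> ranges over all representatives of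
  the weak gradient of \<open>\<phi>\<close>; they give the same integral.\<close>

definition W1p_quasiconvex_at :: "real \<Rightarrow> (real^'n^'m \<Rightarrow> ereal) \<Rightarrow> real^'n^'m \<Rightarrow> bool" where
  "W1p_quasiconvex_at p f \<xi> \<longleftrightarrow>
     (\<exists>\<Omega>. \<Omega> \<noteq> {} \<and> bounded \<Omega> \<and> open \<Omega> \<and> emeasure lebesgue (frontier \<Omega>) = 0 \<and>
        (\<forall>\<phi> \<in> sobolev0 p \<Omega>. \<forall>G. has_weak_gradient \<phi> G \<Omega> \<longrightarrow>
           extended_integral (lebesgue_on \<Omega>) (\<lambda>x. f (\<xi> + G x))
             \<ge> ereal (measure lebesgue \<Omega>) * f \<xi>))"

definition W1p_quasiconvex :: "real \<Rightarrow> (real^'n^'m \<Rightarrow> ereal) \<Rightarrow> bool" where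
  "W1p_quasiconvex p f \<longleftrightarrow> (\<forall>\<xi>. W1p_quasiconvex_at p f \<xi>)"

end

theory Submission imports Defs begin

text \<open>Induction on the rank: let \<open>\<xi>\<close> be a sum of \<open>r \<ge> k\<close> rank-one matrices \<open>a i \<otimes> b i\<close> and suppose
  \<open>f \<le> \<gamma>\<close> on matrices of rank below \<open>r\<close>. Replacing the coefficients \<open>1\<close> of the summands, one after the
  other, by \<open>0\<close> or \<open>2\<close> with weight one half each writes \<open>\<xi>\<close> as a laminate of matrices of lower rank and, with
  weight \<open>2 ^ - r\<close>, the matrix \<open>2 \<xi>\<close>; the next round starts at \<open>2 \<xi>\<close>, and so on. This staircase is
  realised by smooth maps: the map of round \<open>N\<close> is supported in an open set \<open>D N\<close> of measure at most
  \<open>2 ^ - (r N)\<close> times that of \<open>\<Omega>\<close>, has gradient of order \<open>2 ^ N\<close>, and \<open>\<xi>\<close> plus the accumulated gradient is exactly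
  \<open>2 ^ (N + 1) \<xi>\<close> on \<open>D (N + 1)\<close>. As \<open>p < r\<close>, the sum of these maps converges in the Sobolev norm, and \<open>\<xi>\<close> plus the
  limiting gradient has rank below \<open>r\<close> off small sets on which \<open>f\<close> was bounded before their
  size was chosen. Quasiconvexity tested with the limit gives \<open>f \<xi> \<le> \<gamma>\<close>.\<close>

section \<open>Smooth functions\<close>

text \<open>Derivatives at a point are unique, so an explicitly given \<open>f'\<close> may replace
  the one chosen by \<open>frechet_derivative\<close>.\<close>

lemma Ck_SucI:
  assumes "\<And>x. (f has_derivative f' x) (at x)" and "\<And>v. Ck k (\<lambda>x. f' x v)"
  shows "Ck (Suc k) f"
proof -
  have "frechet_derivative f (at x) = f' x" for x
    using frechet_derivative_at[OF assms(1)] by simp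
  then show ?thesis
    using assms by (auto simp: differentiable_def)
qed

lemma Ck_SucD: "Ck (Suc k) f \<Longrightarrow> Ck k f"
proof (induction k arbitrary: f)
  case 0
  then show ?case
    by (auto intro!: differentiable_imp_continuous_on simp: differentiable_on_def
        intro: differentiable_at_withinI)
next
  case (Suc k)
  then show ?case by (metis Ck.simps(2))
qed

lemma Ck_continuous: "Ck k f \<Longrightarrow> continuous_on UNIV f"
proof (induction k)
  case (Suc k)
  then show ?case using Ck_SucD by blast
qed simp

lemma Ck_Suc_has_derivative:
  "Ck (Suc k) f \<Longrightarrow> (f has_derivative frechet_derivative f (at x)) (at x)"
  by (simp add: frechet_derivative_works)

lemma Ck_const: "Ck k (\<lambda>x. c)"
proof (induction k arbitrary: c)
  case (Suc k)
  then show ?case by (intro Ck_SucI[where f' = "\<lambda>_ _. 0"]) auto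
qed auto

lemma Ck_bounded_linear:
  assumes "bounded_linear f"
  shows "Ck k f"
proof (cases k)
  case 0
  then show ?thesis using assms by (simp add: linear_continuous_on)
next
  case (Suc k)
  show ?thesis
    unfolding Suc by (rule Ck_SucI[OF bounded_linear_imp_has_derivative[OF assms] Ck_const])
qed

lemma Ck_ident: "Ck k (\<lambda>x. x)"
  by (rule Ck_bounded_linear[OF bounded_linear_ident])

lemma Ck_add: "Ck k f \<Longrightarrow> Ck k g \<Longrightarrow> Ck k (\<lambda>x. f x + g x)"
proof (induction k arbitrary: f g)
  case 0
  then show ?case by (simp add: continuous_on_add)
next
  case (Suc k)
  show ?case
    by (rule Ck_SucI[OF has_derivative_add[OF Suc.prems[THEN Ck_Suc_has_derivative]]])
      (use Suc in auto)
qed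

lemma Ck_scaleR:
  "Ck k f \<Longrightarrow> Ck k g \<Longrightarrow> Ck k (\<lambda>x. f x *\<^sub>R g x)"
proof (induction k arbitrary: f g)
  case 0
  then show ?case by (simp add: continuous_on_scaleR)
next
  case (Suc k)
  show ?case
    by (rule Ck_SucI[OF has_derivative_scaleR[OF Suc.prems[THEN Ck_Suc_has_derivative]]])
      (use Suc Suc.prems[THEN Ck_SucD] in \<open>auto intro!: Ck_add\<close>)
qed

lemma Ck_mult:
  fixes f g :: "'a::euclidean_space \<Rightarrow> real"
  shows "Ck k f \<Longrightarrow> Ck k g \<Longrightarrow> Ck k (\<lambda>x. f x * g x)"
  using Ck_scaleR[of k f g] by simp

lemma Ck_diff: "Ck k f \<Longrightarrow> Ck k g \<Longrightarrow> Ck k (\<lambda>x. f x - g x)"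
  using Ck_add[of k f "\<lambda>x. (-1) *\<^sub>R g x"] Ck_scaleR[of k "\<lambda>_. -1" g] by (simp add: Ck_const)

lemma Ck_prod:
  fixes f :: "'i \<Rightarrow> 'a::euclidean_space \<Rightarrow> real"
  shows "(\<And>i. i \<in> A \<Longrightarrow> Ck k (f i)) \<Longrightarrow> Ck k (\<lambda>x. \<Prod>i\<in>A. f i x)"
  by (induction A rule: infinite_finite_induct) (auto intro: Ck_const Ck_mult)

text \<open>The outer function has a real argument, so its derivative is determined by the value in
  direction 1. The chain rule then gives a scalar function times a composition of the same kind, one
  order lower, and the induction closes.\<close>

lemma Ck_compose:
  fixes g :: "real \<Rightarrow> 'b::real_normed_vector"
  shows "Ck k g \<Longrightarrow> Ck k q \<Longrightarrow> Ck k (\<lambda>x. g (q x))"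
proof (induction k arbitrary: g q)
  case 0
  then show ?case using continuous_on_compose2[of UNIV g UNIV q] by auto
next
  case (Suc k)
  let ?g = "\<lambda>t. frechet_derivative g (at t) 1" and ?q = "\<lambda>x. frechet_derivative q (at x)"
  have g: "frechet_derivative g (at t) s = s *\<^sub>R ?g t" for s t
    using linear_scale[OF has_derivative_linear[OF Ck_Suc_has_derivative[OF Suc.prems(1)]], of t s 1]
    by simp
  show ?case
  proof (rule Ck_SucI[where f' = "\<lambda>x v. ?q x v *\<^sub>R ?g (q x)"])
    show "((\<lambda>x. g (q x)) has_derivative (\<lambda>v. ?q x v *\<^sub>R ?g (q x))) (at x)" for x
      using has_derivative_compose[OF Ck_Suc_has_derivative[OF Suc.prems(2)]
          Ck_Suc_has_derivative[OF Suc.prems(1)], of x] by (simp only: g[symmetric])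
    show "Ck k (\<lambda>x. ?q x v *\<^sub>R ?g (q x))" for v
      using Suc.prems Suc.prems(2)[THEN Ck_SucD] by (intro Ck_scaleR Suc.IH) auto
  qed
qed

lemma Ck_real_SucI:
  fixes f :: "real \<Rightarrow> real"
  assumes "\<And>x. (f has_real_derivative f' x) (at x)" and "Ck k f'"
  shows "Ck (Suc k) f"
  by (rule Ck_SucI[OF assms(1)[unfolded has_field_derivative_def]])
    (intro Ck_mult Ck_const assms(2))

lemma Ck_sin: "Ck k (sin :: real \<Rightarrow> real)"
proof -
  \<comment> \<open>Sine and cosine are each other's derivative up to sign, so the induction carries
    both.\<close>
  have "Ck k (sin :: real \<Rightarrow> real) \<and> Ck k (cos :: real \<Rightarrow> real)"
  proof (induction k)
    case (Suc k)
    have "Ck (Suc k) (sin :: real \<Rightarrow> real)"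
      using Suc by (intro Ck_real_SucI[where f' = cos]) (auto intro!: derivative_eq_intros)
    moreover have "Ck (Suc k) (cos :: real \<Rightarrow> real)"
      using Suc Ck_diff[OF Ck_const[of k 0], of sin]
      by (intro Ck_real_SucI[where f' = "\<lambda>x. - sin x"]) (auto intro!: derivative_eq_intros)
    ultimately show ?case ..
  qed (auto intro: continuous_intros)
  then show ?thesis ..
qed

section \<open>Flat exponentials, smooth signs and smooth square waves\<close>

text \<open>The division by \<open>t ^ n\<close> makes the span of the family closed under
  differentiation; \<open>n = 0\<close> is the classical smooth function that is flat at the
  origin.\<close>

definition flat_exp :: "nat \<Rightarrow> real \<Rightarrow> real" where
  "flat_exp n t = (if t > 0 then exp (- (1/t)) / t ^ n else 0)"

text \<open>Inverting the variable turns the limit from the right into the decay of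
  \<open>x ^ n / exp x\<close> at infinity.\<close>

lemma flat_exp_tendsto: "((\<lambda>t. flat_exp n t) \<longlongrightarrow> 0) (at 0)"
proof -
  have "((\<lambda>x::real. x ^ n / exp x) \<longlongrightarrow> 0) at_top" by (rule tendsto_power_div_exp_0)
  then have "((\<lambda>t::real. (inverse t) ^ n / exp (inverse t)) \<longlongrightarrow> 0) (at_right 0)"
    by (rule filterlim_compose[OF _ filterlim_inverse_at_top_right])
  then have "((\<lambda>t. flat_exp n t) \<longlongrightarrow> 0) (at_right 0)"
    by (rule Lim_transform_eventually)
      (auto simp: flat_exp_def eventually_at_filter exp_minus field_simps)
  moreover have "((\<lambda>t. flat_exp n t) \<longlongrightarrow> 0) (at_left 0)"
    by (rule Lim_transform_eventually[OF tendsto_const])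
      (auto simp: flat_exp_def eventually_at_filter)
  ultimately show ?thesis by (simp add: filterlim_at_split)
qed

lemma flat_exp_has_derivative:
  "(flat_exp n has_real_derivative flat_exp (n + 2) t - real n * flat_exp (n + 1) t) (at t)"
proof -
  consider "t < 0" | "t = 0" | "t > 0" by linarith
  then show ?thesis
  proof cases
    case 1
    have "((\<lambda>_. 0) has_real_derivative flat_exp (n + 2) t - real n * flat_exp (n + 1) t) (at t)"
      using 1 by (simp add: flat_exp_def)
    then show ?thesis
      by (rule has_field_derivative_transform_within_open[where S = "{..<0}"])
        (use 1 in \<open>auto simp: flat_exp_def\<close>)
  next
    case 2
    \<comment> \<open>The difference quotient at the origin is itself the next member of the family,
      so \<open>flat_exp_tendsto\<close> settles differentiability there.\<close>
    have "(\<lambda>h. (flat_exp n (0 + h) - flat_exp n 0) / h) = flat_exp (n + 1)"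
      by (auto simp: flat_exp_def fun_eq_iff)
    then show ?thesis
      using 2 flat_exp_tendsto[of "n + 1"] flat_exp_def[of _ 0] by (simp add: DERIV_def)
  next
    case 3
    have "((\<lambda>t. exp (- (1/t)) / t ^ n) has_real_derivative
        flat_exp (n + 2) t - real n * flat_exp (n + 1) t) (at t)"
    proof (cases n)
      case 0
      then show ?thesis
        using 3 by (auto intro!: derivative_eq_intros simp: flat_exp_def field_simps power2_eq_square)
    next
      case (Suc i)
      then show ?thesis
        using 3 by (auto intro!: derivative_eq_intros simp: flat_exp_def)
          (cases i; simp add: field_simps power2_eq_square)
    qed
    then show ?thesis
      by (rule has_field_derivative_transform_within_open[where S = "{0<..}"])
        (use 3 in \<open>auto simp: flat_exp_def\<close>)
  qed
qed

lemma Ck_flat_exp: "Ck k (flat_exp n)"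
proof (induction k arbitrary: n)
  case 0
  show ?case
    using flat_exp_has_derivative[THEN DERIV_isCont] by (simp add: continuous_at_imp_continuous_on)
next
  case (Suc k)
  show ?case
    by (rule Ck_real_SucI[OF flat_exp_has_derivative]) (intro Ck_diff Ck_mult Ck_const Suc)
qed

lemma real_antiderivative_exists:
  fixes f :: "real \<Rightarrow> real"
  assumes "continuous_on UNIV f"
  obtains F where "\<And>x. (F has_real_derivative f x) (at x)"
proof -
  define F where "F x = (if x \<ge> 0 then integral {0..x} f else - integral {x..0} f)" for x
  have "(F has_real_derivative f x) (at x)" for x
  proof -
    \<comment> \<open>This radius puts \<open>x\<close> in the interior of the interval, on which
      \<open>F\<close> differs from the integral with lower end \<open>-R\<close> by a
      constant.\<close>
    define R where "R = \<bar>x\<bar> + 1"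
    have cont: "continuous_on {-R..R} f" using assms continuous_on_subset by blast
    have intg: "f integrable_on {a..b}" for a b :: real
      using assms continuous_on_subset integrable_continuous_real by blast
    have "((\<lambda>u. integral {-R..u} f - integral {-R..0} f) has_real_derivative f x) (at x within {-R..R})"
    proof -
      have "x \<in> {-R..R}" by (simp add: R_def abs_if)
      from DERIV_diff[OF integral_has_real_derivative[OF cont this] DERIV_const]
      show ?thesis by simp
    qed
    moreover have "at x within {-R..R} = at x"
      by (rule at_within_interior) (simp add: R_def abs_if)
    ultimately have D: "((\<lambda>u. integral {-R..u} f - integral {-R..0} f) has_real_derivative f x) (at x)"
      by simp
    have eq: "integral {-R..u} f - integral {-R..0} f = F u" if "u \<in> {-R<..<R}" for u
    proof (cases "u \<ge> 0")
      case True
      then show ?thesis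
        using that Henstock_Kurzweil_Integration.integral_combine[of "-R" 0 u f] intg by (simp add: F_def R_def)
    next
      case False
      then show ?thesis
        using that Henstock_Kurzweil_Integration.integral_combine[of "-R" u 0 f] intg by (simp add: F_def R_def)
    qed
    show ?thesis
      by (rule has_field_derivative_transform_within_open[OF D, where S = "{-R<..<R}"])
        (use eq in \<open>auto simp: R_def abs_if\<close>)
  qed
  then show ?thesis by (rule that)
qed

text \<open>A product of two flat exponentials is a bump that is positive exactly between
  \<open>- \<delta>\<close> and \<open>\<delta>\<close>. Its antiderivative is constant on either
  side of that interval; the normalised odd part of the antiderivative is the required
  function.\<close>

lemma smooth_sign_exists:
  assumes "\<delta> > 0"
  obtains S :: "real \<Rightarrow> real" where "\<And>k. Ck k S" "\<And>y. S (- y) = - S y" "\<And>y. \<bar>S y\<bar> \<le> 1"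
    "\<And>y. y \<ge> \<delta> \<Longrightarrow> S y = 1" "\<And>y. y \<le> - \<delta> \<Longrightarrow> S y = -1"
proof -
  define b where "b y = flat_exp 0 (\<delta> + y) * flat_exp 0 (\<delta> - y)" for y
  have Ckb: "Ck k b" for k
    unfolding b_def
    by (rule Ck_mult; rule Ck_compose[OF Ck_flat_exp])
      (auto intro: Ck_add Ck_diff Ck_const Ck_ident)
  obtain F where F: "\<And>x. (F has_real_derivative b x) (at x)"
    using real_antiderivative_exists[of b] Ckb[of 0] by auto
  have CkF: "Ck k F" for k
    using Ck_SucD[OF Ck_real_SucI[OF F Ckb]] .
  have b_nonneg: "b y \<ge> 0" for y by (simp add: b_def flat_exp_def)
  have b0: "b y = 0" if "\<bar>y\<bar> \<ge> \<delta>" for y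
    using that by (auto simp: b_def flat_exp_def abs_if split: if_splits)
  have bpos: "b y > 0" if "\<bar>y\<bar> < \<delta>" for y
    using that by (auto simp: b_def flat_exp_def abs_if split: if_splits)
  have mono: "F x \<le> F y" if "x \<le> y" for x y
    using DERIV_nonneg_imp_nondecreasing[OF that, of F] F b_nonneg by blast
  have right: "F y = F \<delta>" if "y \<ge> \<delta>" for y
  proof (rule antisym)
    show "F y \<le> F \<delta>"
    proof (rule DERIV_nonpos_imp_nonincreasing[OF that])
      fix x assume "\<delta> \<le> x"
      then show "\<exists>z. (F has_real_derivative z) (at x) \<and> z \<le> 0"
        using F[of x] b0[of x] by auto
    qed
  qed (use mono that in auto)
  have left: "F y = F (- \<delta>)" if "y \<le> - \<delta>" for y
  proof (rule antisym)
    show "F (- \<delta>) \<le> F y"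
    proof (rule DERIV_nonpos_imp_nonincreasing[OF that])
      fix x assume "x \<le> - \<delta>"
      then show "\<exists>z. (F has_real_derivative z) (at x) \<and> z \<le> 0"
        using F[of x] b0[of x] by auto
    qed
  qed (use mono that in auto)
  have "F (-\<delta>) < F \<delta>"
  proof (rule DERIV_pos_imp_increasing_open[of "- \<delta>" \<delta> F])
    show "- \<delta> < \<delta>" using assms by simp
    show "\<exists>y. (F has_real_derivative y) (at x) \<and> 0 < y" if "- \<delta> < x" "x < \<delta>" for x
      using F[of x] bpos[of x] that by (auto simp: abs_if)
    show "continuous_on {- \<delta>..\<delta>} F" using Ck_continuous[OF CkF] continuous_on_subset by blast
  qed
  then have pos: "F \<delta> - F (-\<delta>) > 0" by simp
  have lo: "F (-\<delta>) \<le> F y" for y using mono[of "-\<delta>" y] left[of y] by (cases "y \<ge> -\<delta>") auto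
  have hi: "F y \<le> F \<delta>" for y using mono[of y \<delta>] right[of y] by (cases "y \<le> \<delta>") auto
  define S where "S y = (F y - F (- y)) * inverse (F \<delta> - F (-\<delta>))" for y
  show ?thesis
  proof
    show "Ck k S" for k
      unfolding S_def
      by (intro Ck_mult[OF Ck_diff[OF CkF Ck_compose[OF CkF]] Ck_const] Ck_bounded_linear
          bounded_linear_minus bounded_linear_ident)
    show "S (- y) = - S y" for y by (simp add: S_def algebra_simps)
    show "\<bar>S y\<bar> \<le> 1" for y
    proof -
      have "\<bar>F y - F (-y)\<bar> \<le> F \<delta> - F (-\<delta>)"
        using lo[of y] lo[of "-y"] hi[of y] hi[of "-y"] by linarith
      then show ?thesis using pos by (simp add: S_def abs_mult field_simps)
    qed
    show "S y = 1" if "y \<ge> \<delta>" for y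
      using that right[of y] left[of "-y"] pos by (simp add: S_def)
    show "S y = - 1" if "y \<le> - \<delta>" for y
      using that right[of "-y"] left[of "y"] pos by (simp add: S_def divide_simps)
  qed
qed

text \<open>The smooth sign of the sine is a smooth square wave \<open>w\<close>. Its antiderivative
  \<open>H\<close> is bounded because \<open>w\<close> has mean zero over a period; this is what
  later makes a map of high frequency small while its gradient stays of order one.\<close>

lemma smooth_wave_exists:
  assumes "\<delta> > 0"
  obtains H w :: "real \<Rightarrow> real" where "\<And>k. Ck k H" "\<And>x. (H has_real_derivative w x) (at x)"
    "\<And>x. \<bar>w x\<bar> \<le> 1" "\<And>x. \<bar>H x\<bar> \<le> 7"
    "\<And>x. sin x \<ge> \<delta> \<Longrightarrow> w x = 1" "\<And>x. sin x \<le> - \<delta> \<Longrightarrow> w x = -1"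
proof -
  obtain S :: "real \<Rightarrow> real" where S: "\<And>k. Ck k S" "\<And>y. S (- y) = - S y" "\<And>y. \<bar>S y\<bar> \<le> 1"
    "\<And>y. y \<ge> \<delta> \<Longrightarrow> S y = 1" "\<And>y. y \<le> - \<delta> \<Longrightarrow> S y = -1"
    using smooth_sign_exists[OF assms] by blast
  define w where "w x = S (sin x)" for x
  have Ckw: "Ck k w" for k
    unfolding w_def by (rule Ck_compose[OF S(1) Ck_sin])
  obtain F where F: "\<And>x. (F has_real_derivative w x) (at x)"
    using real_antiderivative_exists[of w] Ckw[of 0] by auto
  define H where "H x = F x - F 0" for x
  have H: "(H has_real_derivative w x) (at x)" for x
    unfolding H_def using F[of x] by (auto intro!: derivative_eq_intros)
  have w1: "\<bar>w x\<bar> \<le> 1" for x by (simp add: w_def S)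
  have Lip: "\<bar>H x - H y\<bar> \<le> \<bar>x - y\<bar>" for x y
    using field_differentiable_bound[of UNIV H w 1 x y] H w1 by auto
  text \<open>The wave changes sign under a shift by half a period, so its antiderivative is periodic.\<close>
  have "((\<lambda>x. H (x + pi) + H x) has_real_derivative 0) (at x)" for x
  proof -
    have "((\<lambda>x. H (x + pi)) has_real_derivative w (x + pi)) (at x)"
      using H[of "x + pi"] by (simp add: DERIV_shift)
    then show ?thesis
      using H[of x] by (auto intro!: derivative_eq_intros simp: w_def S)
  qed
  then have anti: "H (x + pi) + H x = H (y + pi) + H y" for x y
    using DERIV_isconst_all[of "\<lambda>x. H (x + pi) + H x"] by blast
  have per: "H (x + 2 * pi) = H x" for x
  proof -
    have "x + pi + pi = x + 2 * pi" by simp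
    moreover have "H (x + pi + pi) = H x" using anti[of "x + pi" x] by linarith
    ultimately show ?thesis by (simp only:)
  qed
  have pern: "H (x + 2 * pi * real n) = H x" for x n
  proof (induction n)
    case (Suc n)
    have "x + 2 * pi * real (Suc n) = (x + 2 * pi * real n) + 2 * pi"
      by (simp add: algebra_simps)
    then show ?case using Suc per by metis
  qed simp
  have peri: "H (x + 2 * pi * of_int i) = H x" for x i
  proof (cases "i \<ge> 0")
    case True
    then show ?thesis using pern[of x "nat i"] by simp
  next
    case False
    then show ?thesis using pern[of "x + 2 * pi * of_int i" "nat (- i)"] by (simp add: algebra_simps)
  qed
  show ?thesis
  proof
    show "Ck k H" for k using Ck_SucD[OF Ck_real_SucI[OF H Ckw]] .
    show "\<bar>H x\<bar> \<le> 7" for x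
    proof -
      \<comment> \<open>Periodicity moves the argument into one period, where the Lipschitz bound
        and \<open>H 0 = 0\<close> give the bound \<open>2 * pi\<close>, which is below 7.\<close>
      define y where "y = x + 2 * pi * of_int (- \<lfloor>x / (2 * pi)\<rfloor>)"
      have y: "y = 2 * pi * frac (x / (2 * pi))" by (simp add: y_def frac_def algebra_simps)
      have "frac (x / (2 * pi)) \<ge> 0" "frac (x / (2 * pi)) < 1" by (simp_all add: frac_lt_1)
      then have "0 \<le> y" "y \<le> 2 * pi" using y by (auto intro: mult_left_le)
      moreover have "\<bar>H y - H 0\<bar> \<le> \<bar>y - 0\<bar>" by (rule Lip)
      moreover have "H 0 = 0" by (simp add: H_def)
      moreover have "H y = H x" unfolding y_def by (rule peri)
      ultimately show ?thesis using pi_less_4 pi_approx by simp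
    qed
    show "\<bar>w x\<bar> \<le> 1" "sin x \<ge> \<delta> \<Longrightarrow> w x = 1" "sin x \<le> - \<delta> \<Longrightarrow> w x = -1" for x
      using w1 S by (auto simp: w_def)
  qed (rule H)
qed

section \<open>Test functions\<close>

text \<open>Compact sets are closed, so any compact set off which the function vanishes contains the
  support.\<close>

lemma test_functionsI:
  assumes "\<And>k. Ck k \<phi>" "compact K" "K \<subseteq> \<Omega>" "\<And>x. x \<notin> K \<Longrightarrow> \<phi> x = 0"
  shows "\<phi> \<in> test_functions \<Omega>"
proof -
  have "closure {x. \<phi> x \<noteq> 0} \<subseteq> K"
    using assms by (intro closure_minimal compact_imp_closed) auto
  then show ?thesis
    using assms compact_Int_closed[OF assms(2) closed_closure[of "{x. \<phi> x \<noteq> 0}"]]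
    by (auto simp: test_functions_def Int_absorb1)
qed

lemma test_functionsE:
  assumes "\<phi> \<in> test_functions \<Omega>"
  obtains K where "\<And>k. Ck k \<phi>" "compact K" "K \<subseteq> \<Omega>" "\<And>x. x \<notin> K \<Longrightarrow> \<phi> x = 0"
  using assms closure_subset[of "{x. \<phi> x \<noteq> 0}"]
  by (intro that[of "closure {x. \<phi> x \<noteq> 0}"]) (auto simp: test_functions_def)

lemma test_functions_mono: "D \<subseteq> \<Omega> \<Longrightarrow> test_functions D \<subseteq> test_functions \<Omega>"
  by (auto simp: test_functions_def)

lemma test_functions_zero: "(\<lambda>_. 0) \<in> test_functions D"
  by (rule test_functionsI[of _ "{}"]) (auto simp: Ck_const)

lemma test_functions_add:
  assumes "\<phi> \<in> test_functions D" "\<psi> \<in> test_functions D"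
  shows "(\<lambda>x. \<phi> x + \<psi> x) \<in> test_functions D"
proof -
  obtain K where K: "\<And>k. Ck k \<phi>" "compact K" "K \<subseteq> D" "\<And>x. x \<notin> K \<Longrightarrow> \<phi> x = 0"
    using test_functionsE[OF assms(1)] by metis
  obtain L where L: "\<And>k. Ck k \<psi>" "compact L" "L \<subseteq> D" "\<And>x. x \<notin> L \<Longrightarrow> \<psi> x = 0"
    using test_functionsE[OF assms(2)] by metis
  show ?thesis
    by (rule test_functionsI[of _ "K \<union> L"]) (use K L in \<open>auto intro: Ck_add\<close>)
qed

lemma test_functions_sum:
  "(\<And>i. i \<in> A \<Longrightarrow> \<phi> i \<in> test_functions D) \<Longrightarrow> (\<lambda>x. \<Sum>i\<in>A. \<phi> i x) \<in> test_functions D"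
  by (induction A rule: infinite_finite_induct)
    (auto intro: test_functions_zero test_functions_add)

lemma test_function_has_derivative:
  "\<phi> \<in> test_functions D \<Longrightarrow> (\<phi> has_derivative frechet_derivative \<phi> (at x)) (at x)"
  unfolding test_functions_def by (auto intro: Ck_Suc_has_derivative[of 0])

text \<open>The function vanishes on the open complement of a compact subset of \<open>D\<close>,
  hence so does its derivative.\<close>

lemma test_function_zero_outside:
  assumes "\<phi> \<in> test_functions D" "x \<notin> D"
  shows "\<phi> x = 0" "frechet_derivative \<phi> (at x) v = 0"
proof -
  obtain K where K: "compact K" "K \<subseteq> D" "\<And>x. x \<notin> K \<Longrightarrow> \<phi> x = 0"
    using test_functionsE[OF assms(1)] by metis
  then have x: "x \<in> - K" using assms by auto
  then show "\<phi> x = 0" using K by auto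
  have "(\<phi> has_derivative (\<lambda>_. 0)) (at x)"
    by (rule has_derivative_transform_within_open[OF has_derivative_const, of "- K"])
      (use K x in \<open>auto intro: compact_imp_closed\<close>)
  then show "frechet_derivative \<phi> (at x) v = 0"
    using frechet_derivative_at by metis
qed

lemma test_functions_derivative:
  assumes "\<phi> \<in> test_functions D"
  shows "(\<lambda>x. frechet_derivative \<phi> (at x) v) \<in> test_functions D"
proof -
  obtain K where K: "\<And>k. Ck k \<phi>" "compact K" "K \<subseteq> D" "\<And>x. x \<notin> K \<Longrightarrow> \<phi> x = 0"
    using test_functionsE[OF assms(1)] by metis
  \<comment> \<open>\<open>test_functions\<close> makes sense for any set, so the compact
    \<open>K\<close> itself can serve as the domain; the derivative then vanishes off
    \<open>K\<close>.\<close>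
  then have "\<phi> \<in> test_functions K" by (intro test_functionsI[of \<phi> K]) auto
  then show ?thesis
    using K(1)[of "Suc _"] by (intro test_functionsI[OF _ K(2,3)]) (auto simp: test_function_zero_outside)
qed

lemma test_function_bounded:
  assumes "\<phi> \<in> test_functions D"
  obtains M where "\<And>x. norm (\<phi> x) \<le> M"
proof -
  obtain K where K: "\<And>k. Ck k \<phi>" "compact K" "\<And>x. x \<notin> K \<Longrightarrow> \<phi> x = 0"
    using test_functionsE[OF assms(1)] by metis
  have "compact (\<phi> ` K)"
    by (intro compact_continuous_image K(2) continuous_on_subset[OF Ck_continuous[OF K(1)[of 0]]]) simp
  from compact_imp_bounded[OF this]
  obtain M where M: "\<And>y. y \<in> \<phi> ` K \<Longrightarrow> norm y \<le> M"
    unfolding bounded_iff by blast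
  have "norm (\<phi> x) \<le> max M 0" for x
    using M[of "\<phi> x"] K(3)[of x] by (cases "x \<in> K") auto
  then show ?thesis by (rule that)
qed

lemma test_function_continuous: "\<phi> \<in> test_functions D \<Longrightarrow> continuous_on S \<phi>"
  using Ck_continuous[of 0 \<phi>] continuous_on_subset unfolding test_functions_def by blast

section \<open>Cutoff functions\<close>

lemma bump_exists:
  fixes c :: "'a::euclidean_space"
  assumes "r > 0"
  obtains \<zeta> :: "'a \<Rightarrow> real" where "\<And>k. Ck k \<zeta>" "\<And>x. 0 \<le> \<zeta> x \<and> \<zeta> x \<le> 1"
    "\<And>x. x \<in> ball c (r / 2) \<Longrightarrow> \<zeta> x = 1" "\<And>x. x \<notin> cball c r \<Longrightarrow> \<zeta> x = 0"
proof -
  obtain S :: "real \<Rightarrow> real" where S: "\<And>k. Ck k S" "\<And>y. \<bar>S y\<bar> \<le> 1"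
    "\<And>y. y \<ge> 1 \<Longrightarrow> S y = 1" "\<And>y. y \<le> - 1 \<Longrightarrow> S y = -1"
    using smooth_sign_exists[of 1] by (metis zero_less_one)
  define t where "t = 3 / r\<^sup>2"
  \<comment> \<open>The squared distance is smooth also at the centre. The constants 3 and 2 make
    \<open>q\<close> at most -1 on the half ball and at least 1 off the full ball, where
    \<open>S\<close> takes its constant values.\<close>
  define q where "q x = t * ((x - c) \<bullet> (x - c)) - 2" for x
  define \<zeta> where "\<zeta> x = (1/2) * (1 - S (q x))" for x
  have q: "q x = 3 * (dist c x / r)\<^sup>2 - 2" for x
    unfolding q_def dot_square_norm dist_norm norm_minus_commute[of c x]
    by (simp add: t_def power_divide)
  show ?thesis
  proof
    have "Ck k q" for k
    proof (rule Ck_SucD, rule Ck_SucI)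
      show "(q has_derivative (\<lambda>v. t * (2 * ((x - c) \<bullet> v)))) (at x)" for x
        unfolding q_def by (auto intro!: derivative_eq_intros simp: inner_commute)
      show "Ck k (\<lambda>x. t * (2 * ((x - c) \<bullet> v)))" for v
        unfolding inner_diff_left
        by (intro Ck_mult Ck_const Ck_diff Ck_bounded_linear bounded_linear_inner_left)
    qed
    then show "Ck k \<zeta>" for k
      unfolding \<zeta>_def by (intro Ck_mult Ck_const Ck_diff) (rule Ck_compose[OF S(1)])
    show "0 \<le> \<zeta> x \<and> \<zeta> x \<le> 1" for x
      using S(2)[of "q x"] by (auto simp: \<zeta>_def)
    show "\<zeta> x = 1" if "x \<in> ball c (r / 2)" for x
    proof -
      have "(dist c x / r)\<^sup>2 \<le> (1/2)\<^sup>2"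
        using that assms by (intro power_mono) (auto simp: field_simps)
      then have "q x \<le> -1" by (simp add: q power2_eq_square)
      then show ?thesis using S(4) by (simp add: \<zeta>_def)
    qed
    show "\<zeta> x = 0" if "x \<notin> cball c r" for x
    proof -
      have "1\<^sup>2 \<le> (dist c x / r)\<^sup>2"
        using that assms by (intro power_mono) (auto simp: field_simps)
      then have "q x \<ge> 1" by (simp add: q)
      then show ?thesis using S(3) by (simp add: \<zeta>_def)
    qed
  qed
qed

text \<open>Finitely many half balls cover \<open>K\<close>. Subtracting from 1 the product of all
  \<open>1 - z c\<close> keeps the values in the unit interval and gives 1 wherever one bump is 1.
  The open set \<open>U\<close> is recorded because the derivative of the cutoff vanishes on
  it.\<close>

lemma smooth_cutoff_exists:
  fixes D :: "'a::euclidean_space set"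
  assumes "open D" "compact K" "K \<subseteq> D"
  obtains \<zeta> :: "'a \<Rightarrow> real" and U where "\<zeta> \<in> test_functions D" "\<And>x. 0 \<le> \<zeta> x \<and> \<zeta> x \<le> 1"
    "open U" "K \<subseteq> U" "U \<subseteq> D" "\<And>x. x \<in> U \<Longrightarrow> \<zeta> x = 1"
proof -
  have "\<exists>r>0. cball x r \<subseteq> D" if "x \<in> K" for x
    using assms that open_contains_cball by blast
  then obtain r where r: "\<And>x. x \<in> K \<Longrightarrow> r x > 0 \<and> cball x (r x) \<subseteq> D" by metis
  have "K \<subseteq> (\<Union>x\<in>K. ball x (r x / 2))" using r by force
  then obtain F where F: "F \<subseteq> K" "finite F" "K \<subseteq> (\<Union>x\<in>F. ball x (r x / 2))"
    by (rule compactE_image[OF assms(2) open_ball])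
  have "\<exists>\<zeta>. (\<forall>k. Ck k \<zeta>) \<and> (\<forall>x. 0 \<le> \<zeta> x \<and> \<zeta> x \<le> (1::real)) \<and> (\<forall>x\<in>ball c (r c / 2). \<zeta> x = 1)
      \<and> (\<forall>x. x \<notin> cball c (r c) \<longrightarrow> \<zeta> x = 0)" if "c \<in> F" for c
  proof -
    have "r c > 0" using r F that by auto
    then obtain \<zeta> :: "'a \<Rightarrow> real" where "\<And>k. Ck k \<zeta>" "\<And>x. 0 \<le> \<zeta> x \<and> \<zeta> x \<le> 1"
        "\<And>x. x \<in> ball c (r c / 2) \<Longrightarrow> \<zeta> x = 1" "\<And>x. x \<notin> cball c (r c) \<Longrightarrow> \<zeta> x = 0"
      using bump_exists[of "r c" c] by blast
    then show ?thesis by blast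
  qed
  then obtain z where z: "\<And>c. c \<in> F \<Longrightarrow> (\<forall>k. Ck k (z c)) \<and> (\<forall>x. 0 \<le> z c x \<and> z c x \<le> (1::real)) \<and>
      (\<forall>x\<in>ball c (r c / 2). z c x = 1) \<and> (\<forall>x. x \<notin> cball c (r c) \<longrightarrow> z c x = 0)"
    by metis
  define \<zeta> where "\<zeta> x = 1 - (\<Prod>c\<in>F. 1 - z c x)" for x
  show ?thesis
  proof
    show "\<zeta> \<in> test_functions D"
    proof (rule test_functionsI[of _ "\<Union>c\<in>F. cball c (r c)"])
      show "Ck k \<zeta>" for k
        unfolding \<zeta>_def by (intro Ck_diff Ck_const Ck_prod) (use z in auto)
      show "\<zeta> x = 0" if "x \<notin> (\<Union>c\<in>F. cball c (r c))" for x
        using that z by (simp add: \<zeta>_def)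
    qed (use F r in auto)
    show "0 \<le> \<zeta> x \<and> \<zeta> x \<le> 1" for x
      unfolding \<zeta>_def using z prod_nonneg[of F "\<lambda>c. 1 - z c x"] prod_le_1[of F "\<lambda>c. 1 - z c x"]
      by auto
    show "open (\<Union>x\<in>F. ball x (r x / 2))" by auto
    show "K \<subseteq> (\<Union>x\<in>F. ball x (r x / 2))" by fact
    show "(\<Union>x\<in>F. ball x (r x / 2)) \<subseteq> D"
    proof (intro UN_least)
      fix c assume "c \<in> F"
      then have "r c > 0" "cball c (r c) \<subseteq> D" using r F by auto
      moreover have "ball c (r c / 2) \<subseteq> cball c (r c)" using \<open>r c > 0\<close> by auto
      ultimately show "ball c (r c / 2) \<subseteq> D" by blast
    qed
    show "\<zeta> x = 1" if "x \<in> (\<Union>x\<in>F. ball x (r x / 2))" for x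
      using that z F(2) prod_zero[of F "\<lambda>c. 1 - z c x"] by (force simp: \<zeta>_def)
  qed
qed

section \<open>Laminates\<close>

definition outer :: "real^'m \<Rightarrow> real^'n \<Rightarrow> real^'n^'m" where
  "outer a b = (\<chi> i. a $ i *\<^sub>R b)"

lemma matrix_inner_scaleR: "matrix (\<lambda>v. (b \<bullet> v) *\<^sub>R a) = outer a b"
  by (simp add: matrix_def outer_def vec_eq_iff inner_axis)

lemma jacobian_eq: "(f has_derivative f') (at x) \<Longrightarrow> jacobian f (at x) = matrix f'"
  using frechet_derivative_at[of f f' x] by (simp add: jacobian_def)

lemma matrix_add: "matrix (\<lambda>v. f v + g v) = matrix f + matrix g"
  by (simp add: matrix_def vec_eq_iff)

lemma matrix_scaleR: "matrix (\<lambda>v. c *\<^sub>R f v) = c *\<^sub>R matrix f"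
  by (simp add: matrix_def vec_eq_iff)

lemma jacobian_component: "jacobian \<phi> (at x) $ i $ j = frechet_derivative \<phi> (at x) (axis j 1) $ i"
  by (simp add: jacobian_def matrix_def)

lemma jacobian_add:
  assumes "\<phi> \<in> test_functions D" "\<psi> \<in> test_functions E"
  shows "jacobian (\<lambda>x. \<phi> x + \<psi> x) (at x) = jacobian \<phi> (at x) + jacobian \<psi> (at x)"
  unfolding jacobian_eq[OF has_derivative_add[OF test_function_has_derivative[OF assms(1)]
        test_function_has_derivative[OF assms(2)]]] matrix_add
  by (simp add: jacobian_def)

lemma jacobian_sum:
  assumes "\<And>i. i \<in> A \<Longrightarrow> \<phi> i \<in> test_functions D"
  shows "jacobian (\<lambda>x. \<Sum>i\<in>A. \<phi> i x) (at x) = (\<Sum>i\<in>A. jacobian (\<phi> i) (at x))"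
  using assms
proof (induction A rule: infinite_finite_induct)
  case (insert i A)
  then show ?case
    using jacobian_add[of "\<phi> i" D "\<lambda>x. \<Sum>i\<in>A. \<phi> i x" D x] test_functions_sum[of A \<phi> D] by simp
qed (auto simp: jacobian_eq[OF has_derivative_const] matrix_def vec_eq_iff)

lemma jacobian_zero_outside:
  "\<phi> \<in> test_functions D \<Longrightarrow> x \<notin> D \<Longrightarrow> jacobian \<phi> (at x) = 0"
  by (simp add: vec_eq_iff jacobian_component test_function_zero_outside)

lemma continuous_on_jacobian:
  assumes "\<phi> \<in> test_functions D"
  shows "continuous_on S (\<lambda>x. jacobian \<phi> (at x))"
proof -
  have "jacobian \<phi> (at x) = (\<chi> i j. frechet_derivative \<phi> (at x) (axis j 1) $ i)" for x
    by (simp add: vec_eq_iff jacobian_component)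
  then show ?thesis
    by (auto intro!: continuous_intros test_function_continuous[OF test_functions_derivative[OF assms]])
qed

lemma jacobian_bounded:
  assumes "\<phi> \<in> test_functions D"
  obtains M where "\<And>x. norm (jacobian \<phi> (at x)) \<le> M"
proof -
  obtain K where K: "\<And>k. Ck k \<phi>" "compact K" "\<And>x. x \<notin> K \<Longrightarrow> \<phi> x = 0"
    using test_functionsE[OF assms(1)] by metis
  then have \<phi>: "\<phi> \<in> test_functions K" by (intro test_functionsI[of \<phi> K]) auto
  have "compact ((\<lambda>x. jacobian \<phi> (at x)) ` K)"
    using K(2) by (intro compact_continuous_image continuous_on_jacobian[OF assms])
  from compact_imp_bounded[OF this]
  obtain M where M: "\<And>y. y \<in> (\<lambda>x. jacobian \<phi> (at x)) ` K \<Longrightarrow> norm y \<le> M"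
    unfolding bounded_iff by blast
  have "norm (jacobian \<phi> (at x)) \<le> max M 0" for x
    using M[of "jacobian \<phi> (at x)"] jacobian_zero_outside[OF \<phi>, of x] by (cases "x \<in> K") auto
  then show ?thesis by (rule that)
qed

section \<open>Oscillation in a single rank-one direction\<close>

text \<open>The zeros lie on countably many hyperplanes orthogonal to \<open>b\<close>.\<close>

lemma negligible_sin_zero:
  fixes b :: "'a::euclidean_space"
  assumes "b \<noteq> 0"
  shows "negligible {x. sin (b \<bullet> x) = 0}"
proof -
  have "{x. sin (b \<bullet> x) = 0} \<subseteq> (\<Union>i::int. {x. b \<bullet> x = of_int i * pi})"
    using sin_zero_iff_int2 by auto
  moreover have "negligible (\<Union>i::int. {x. b \<bullet> x = of_int i * pi})"
    by (rule negligible_countable_Union) (use assms in \<open>auto intro: negligible_hyperplane\<close>)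
  ultimately show ?thesis by (rule negligible_subset[rotated])
qed

text \<open>As the threshold tends to 0 the sets decrease to a part of the null set where the sine
  vanishes; continuity from above for sets of finite measure gives the claim.\<close>

lemma small_sin_small_measure:
  fixes b :: "'a::euclidean_space"
  assumes "b \<noteq> 0" "open D" "bounded D" "\<epsilon> > 0"
  obtains \<delta> where "\<delta> > 0" "measure lebesgue {x\<in>D. \<bar>sin (b \<bullet> x)\<bar> \<le> \<delta>} < \<epsilon>"
proof -
  define A where "A n = {x\<in>D. \<bar>sin (b \<bullet> x)\<bar> \<le> inverse (real (Suc n))}" for n
  have D: "D \<in> lmeasurable" using assms by (simp add: lmeasurable_open)
  have closed: "closed {x. \<bar>sin (b \<bullet> x)\<bar> \<le> c}" for c
    by (intro closed_Collect_le continuous_intros)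
  have A: "A n \<in> lmeasurable" for n
    using fmeasurable_Int_fmeasurable[OF D, of "{x. \<bar>sin (b \<bullet> x)\<bar> \<le> inverse (real (Suc n))}"] closed
    by (simp add: A_def Collect_conj_eq)
  have "(\<lambda>n. measure lebesgue (A n)) \<longlonglongrightarrow> measure lebesgue (\<Inter>n. A n)"
  proof (rule Lim_measure_decseq)
    show "range A \<subseteq> sets lebesgue" using A by auto
    show "decseq A"
      unfolding decseq_Suc_iff A_def by (auto intro: order_trans)
    show "emeasure lebesgue (A n) \<noteq> \<infinity>" for n
      unfolding infinity_ennreal_def by (rule fmeasurableD2[OF A])
  qed
  moreover have "measure lebesgue (\<Inter>n. A n) = 0"
  proof -
    have "(\<Inter>n. A n) \<subseteq> {x. sin (b \<bullet> x) = 0}"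
    proof
      fix x assume "x \<in> (\<Inter>n. A n)"
      then have "\<bar>sin (b \<bullet> x)\<bar> \<le> inverse (real (Suc n))" for n by (auto simp: A_def)
      then have "\<bar>sin (b \<bullet> x)\<bar> \<le> 0"
        by (intro LIMSEQ_le_const[OF LIMSEQ_inverse_real_of_nat]) auto
      then show "x \<in> {x. sin (b \<bullet> x) = 0}" by simp
    qed
    then show ?thesis
      using negligible_sin_zero[OF assms(1)] negligible_subset negligible_imp_measure0 by blast
  qed
  ultimately have "eventually (\<lambda>n. measure lebesgue (A n) < \<epsilon>) sequentially"
    using assms(4) by (auto intro: order_tendstoD)
  then obtain n where "measure lebesgue (A n) < \<epsilon>" by (auto simp: eventually_sequentially)
  then show ?thesis by (intro that[of "inverse (real (Suc n))"]) (auto simp: A_def)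
qed

text \<open>The map is a wave of high frequency in direction \<open>b\<close> with values along
  \<open>a\<close>, its amplitude inverse to the frequency, multiplied by a cutoff. Where the cutoff
  is 1 and the sine is not small the gradient is plus or minus \<open>outer a b\<close>; elsewhere
  differentiating the cutoff adds an error controlled by the amplitude.\<close>

lemma laminate_step:
  fixes a :: "real^'m" and b :: "real^'n"
  assumes "b \<noteq> 0" "open D" "bounded D" "\<epsilon> > 0"
  obtains \<phi> D' A where "\<phi> \<in> test_functions D" "open D'" "open A" "D' \<subseteq> D" "A \<subseteq> D"
    "measure lebesgue D' \<le> measure lebesgue D / 2" "measure lebesgue (D - D' - A) \<le> \<epsilon>"
    "\<And>x. x \<in> D' \<Longrightarrow> jacobian \<phi> (at x) = outer a b"
    "\<And>x. x \<in> A \<Longrightarrow> jacobian \<phi> (at x) = - outer a b"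
    "\<And>x. norm (jacobian \<phi> (at x)) \<le> norm (outer a b) + 1" "\<And>x. norm (\<phi> x) \<le> 1"
proof -
  have D: "D \<in> lmeasurable" using assms by (simp add: lmeasurable_open)
  \<comment> \<open>The cutoff will be 1 on this set. Half of \<open>\<epsilon>\<close> pays for the
    rest of \<open>D\<close>, the other half for the transition layer of the wave.\<close>
  obtain K where K: "compact K" "K \<subseteq> D" "measure lebesgue (D - K) < \<epsilon> / 2" "D - K \<in> lmeasurable"
  proof -
    obtain K where K: "closed K" "K \<subseteq> D" "D - K \<in> lmeasurable" "emeasure lebesgue (D - K) < ennreal (\<epsilon> / 2)"
      using sets_lebesgue_inner_closed[OF fmeasurableD[OF D], of "\<epsilon> / 2"] assms(4) by auto
    then have "measure lebesgue (D - K) < \<epsilon> / 2"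
      unfolding emeasure_eq_measure2[OF K(3)] using assms(4) by (simp add: ennreal_less_iff)
    moreover have "compact K" using K assms(3) bounded_subset compact_eq_bounded_closed by blast
    ultimately show ?thesis using that[of K] K by blast
  qed
  obtain \<zeta> :: "real^'n \<Rightarrow> real" and U where \<zeta>: "\<zeta> \<in> test_functions D" "\<And>x. 0 \<le> \<zeta> x \<and> \<zeta> x \<le> 1"
    "open U" "K \<subseteq> U" "U \<subseteq> D" "\<And>x. x \<in> U \<Longrightarrow> \<zeta> x = 1"
    using smooth_cutoff_exists[OF assms(2) K(1,2)] by blast
  define \<psi> where "\<psi> x = \<zeta> x *\<^sub>R a" for x
  have \<psi>: "\<psi> \<in> test_functions D"
  proof -
    obtain L where L: "\<And>k. Ck k \<zeta>" "compact L" "L \<subseteq> D" "\<And>x. x \<notin> L \<Longrightarrow> \<zeta> x = 0"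
      using test_functionsE[OF \<zeta>(1)] by metis
    show ?thesis
      unfolding \<psi>_def by (rule test_functionsI[OF _ L(2,3)]) (simp_all add: L Ck_scaleR Ck_const)
  qed
  obtain M where M: "\<And>x. norm (jacobian \<psi> (at x)) \<le> M" using jacobian_bounded[OF \<psi>] by blast
  have "M \<ge> 0" using M norm_ge_zero order_trans by blast
  \<comment> \<open>This frequency makes \<open>7 / j\<close> times \<open>M\<close>, and
    \<open>7 / j\<close> times the norm of \<open>a\<close>, at most 1; here 7 is the bound on
    \<open>H\<close>.\<close>
  define j where "j = 7 * (M + norm a + 1)"
  have j: "j > 0" "7 * M \<le> j" "7 * norm a \<le> j" using \<open>M \<ge> 0\<close> by (simp_all add: j_def add_nonneg_pos)
  define c where "c = j *\<^sub>R b"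
  have "c \<noteq> 0" using j assms by (simp add: c_def)
  \<comment> \<open>The layer depends on the frequency, so its width is chosen only after
    \<open>j\<close> is fixed.\<close>
  obtain \<delta> where \<delta>: "\<delta> > 0" "measure lebesgue {x\<in>D. \<bar>sin (c \<bullet> x)\<bar> \<le> \<delta>} < \<epsilon> / 2"
    using small_sin_small_measure[OF \<open>c \<noteq> 0\<close> assms(2,3), of "\<epsilon> / 2"] assms(4) by auto
  obtain H w :: "real \<Rightarrow> real" where H: "\<And>k. Ck k H" "\<And>x. (H has_real_derivative w x) (at x)"
    "\<And>x. \<bar>w x\<bar> \<le> 1" "\<And>x. \<bar>H x\<bar> \<le> 7"
    "\<And>x. sin x \<ge> \<delta> \<Longrightarrow> w x = 1" "\<And>x. sin x \<le> - \<delta> \<Longrightarrow> w x = -1"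
    using smooth_wave_exists[OF \<delta>(1)] by blast
  text \<open>The sign puts \<open>D'\<close> into the smaller of the sets where the sine is positive and negative.\<close>
  define P where "P s = {x\<in>D. s * sin (c \<bullet> x) > 0}" for s :: real
  have P: "P s \<in> lmeasurable" for s
  proof -
    have "P s = D \<inter> {x. s * sin (c \<bullet> x) > 0}" by (auto simp: P_def)
    moreover have "open {x. s * sin (c \<bullet> x) > 0}" by (intro open_Collect_less continuous_intros)
    ultimately show ?thesis
      using assms(2,3) by (auto intro!: lmeasurable_open bounded_Int)
  qed
  have "measure lebesgue (P 1) + measure lebesgue (P (-1)) = measure lebesgue (P 1 \<union> P (-1))"
  proof (rule measure_Union[symmetric])
    show "P 1 \<inter> P (-1) = {}" by (auto simp: P_def)
  qed (use fmeasurableD[OF P] fmeasurableD2[OF P] in \<open>simp_all only: infinity_ennreal_def, simp_all\<close>)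
  also have "\<dots> \<le> measure lebesgue D"
    by (intro measure_mono_fmeasurable D fmeasurableD fmeasurable.Un P) (auto simp: P_def)
  finally have "\<exists>s\<in>{1,-1}. measure lebesgue (P s) \<le> measure lebesgue D / 2" by auto
  then obtain s where s: "s \<in> {1,-1}" "measure lebesgue (P s) \<le> measure lebesgue D / 2" by blast
  then have s1: "\<bar>s\<bar> = 1" by auto
  define h where "h x = (s / j) * H (c \<bullet> x)" for x
  define \<phi> where "\<phi> x = h x *\<^sub>R \<psi> x" for x
  have h_bd: "\<bar>h x\<bar> \<le> 7 / j" for x
    using H(4)[of "c \<bullet> x"] j s1 by (simp add: h_def abs_mult divide_right_mono)
  have dH: "((\<lambda>x. H (c \<bullet> x)) has_derivative (\<lambda>v. (c \<bullet> v) * w (c \<bullet> x))) (at x)" for x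
    using has_derivative_compose[OF bounded_linear_imp_has_derivative[OF bounded_linear_inner_right[of c]],
      OF H(2)[unfolded has_field_derivative_def], of x] by (simp add: mult.commute)
  have "(h has_derivative (\<lambda>v. (s / j) * ((c \<bullet> v) * w (c \<bullet> x)))) (at x)" for x
    unfolding h_def by (rule has_derivative_mult_right[OF dH])
  then have h': "(h has_derivative (\<lambda>v. s * w (c \<bullet> x) * (b \<bullet> v))) (at x)" for x
    using j by (simp add: c_def mult_ac)
  have jac: "jacobian \<phi> (at x) = h x *\<^sub>R jacobian \<psi> (at x) + (s * w (c \<bullet> x) * \<zeta> x) *\<^sub>R outer a b" for x
  proof -
    have "(\<phi> has_derivative (\<lambda>v. h x *\<^sub>R frechet_derivative \<psi> (at x) v
        + (s * w (c \<bullet> x) * (b \<bullet> v)) *\<^sub>R \<psi> x)) (at x)"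
      unfolding \<phi>_def by (rule has_derivative_scaleR[OF h' test_function_has_derivative[OF \<psi>]])
    then have "jacobian \<phi> (at x) = matrix (\<lambda>v. h x *\<^sub>R frechet_derivative \<psi> (at x) v
        + (s * w (c \<bullet> x) * (b \<bullet> v)) *\<^sub>R \<psi> x)" by (rule jacobian_eq)
    moreover have "(s * w (c \<bullet> x) * (b \<bullet> v)) *\<^sub>R \<psi> x = (s * w (c \<bullet> x) * \<zeta> x) *\<^sub>R ((b \<bullet> v) *\<^sub>R a)" for v
      by (simp add: \<psi>_def mult_ac)
    ultimately show ?thesis
      by (simp only: matrix_add matrix_scaleR matrix_inner_scaleR jacobian_def)
  qed
  \<comment> \<open>On the open set \<open>U\<close> the cutoff is constant, so only the derivative
    of the wave survives.\<close>
  have jacU: "jacobian \<phi> (at x) = (s * w (c \<bullet> x)) *\<^sub>R outer a b" if "x \<in> U" for x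
  proof -
    have "(\<psi> has_derivative (\<lambda>_. 0)) (at x)"
      by (rule has_derivative_transform_within_open[OF has_derivative_const[of a] \<zeta>(3) that])
        (simp add: \<psi>_def \<zeta>)
    then have "jacobian \<psi> (at x) = 0" by (simp add: jacobian_eq matrix_def vec_eq_iff)
    then show ?thesis using jac[of x] \<zeta>(6)[OF that] by simp
  qed
  define D' where "D' = U \<inter> {x. s * sin (c \<bullet> x) > \<delta>}"
  define A where "A = U \<inter> {x. s * sin (c \<bullet> x) < - \<delta>}"
  show ?thesis
  proof
    show "\<phi> \<in> test_functions D"
    proof -
      obtain L where L: "\<And>k. Ck k \<psi>" "compact L" "L \<subseteq> D" "\<And>x. x \<notin> L \<Longrightarrow> \<psi> x = 0"
        using test_functionsE[OF \<psi>] by metis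
      have "Ck k h" for k
        unfolding h_def
        by (intro Ck_mult Ck_const Ck_compose[OF H(1)] Ck_bounded_linear bounded_linear_inner_right)
      then show ?thesis
        unfolding \<phi>_def by (intro test_functionsI[OF _ L(2,3)]) (simp_all add: L Ck_scaleR)
    qed
    show "open D'" unfolding D'_def by (intro open_Int \<zeta> open_Collect_less continuous_intros)
    show "open A" unfolding A_def by (intro open_Int \<zeta> open_Collect_less continuous_intros)
    show "D' \<subseteq> D" "A \<subseteq> D" using \<zeta> by (auto simp: D'_def A_def)
    have "measure lebesgue D' \<le> measure lebesgue (P s)"
      by (rule measure_mono_fmeasurable) (use \<zeta> \<delta> \<open>open D'\<close> P in \<open>auto simp: D'_def P_def\<close>)
    then show "measure lebesgue D' \<le> measure lebesgue D / 2" using s by simp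
    have closed: "closed {x. \<bar>sin (c \<bullet> x)\<bar> \<le> \<delta>}"
      by (intro closed_Collect_le continuous_intros)
    have Z: "{x\<in>D. \<bar>sin (c \<bullet> x)\<bar> \<le> \<delta>} \<in> lmeasurable"
      using fmeasurable_Int_fmeasurable[OF D, of "{x. \<bar>sin (c \<bullet> x)\<bar> \<le> \<delta>}"] closed
      by (simp add: Collect_conj_eq)
    have "measure lebesgue (D - D' - A) \<le> measure lebesgue ((D - K) \<union> {x\<in>D. \<bar>sin (c \<bullet> x)\<bar> \<le> \<delta>})"
    proof (rule measure_mono_fmeasurable)
      show "D - D' - A \<in> sets lebesgue" using \<open>open D'\<close> \<open>open A\<close> assms(2) by auto
      show "D - K \<union> {x\<in>D. \<bar>sin (c \<bullet> x)\<bar> \<le> \<delta>} \<in> lmeasurable" using K Z by blast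
      \<comment> \<open>A point of \<open>D\<close> in neither set lies off \<open>U\<close>, hence
        off \<open>K\<close>, or else in the transition layer.\<close>
      show "D - D' - A \<subseteq> D - K \<union> {x \<in> D. \<bar>sin (c \<bullet> x)\<bar> \<le> \<delta>}"
        using s(1) \<zeta>(4) by (auto simp: D'_def A_def abs_le_iff)
    qed
    also have "\<dots> \<le> measure lebesgue (D - K) + measure lebesgue {x\<in>D. \<bar>sin (c \<bullet> x)\<bar> \<le> \<delta>}"
      by (rule measure_Un_le) (use K Z in auto)
    finally show "measure lebesgue (D - D' - A) \<le> \<epsilon>" using K \<delta> by linarith
    show "jacobian \<phi> (at x) = outer a b" if "x \<in> D'" for x
      using that jacU[of x] s(1) H(5,6)[of "c \<bullet> x"] by (auto simp: D'_def)
    show "jacobian \<phi> (at x) = - outer a b" if "x \<in> A" for x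
      using that jacU[of x] s(1) H(5,6)[of "c \<bullet> x"] by (auto simp: A_def)
    show "norm (jacobian \<phi> (at x)) \<le> norm (outer a b) + 1" for x
    proof -
      have "\<bar>h x\<bar> * norm (jacobian \<psi> (at x)) \<le> (7 / j) * M"
        using h_bd M j by (intro mult_mono) auto
      also have "\<dots> \<le> 1" using j by (simp add: field_simps)
      finally have 1: "norm (h x *\<^sub>R jacobian \<psi> (at x)) \<le> 1" by simp
      have "\<bar>w (c \<bullet> x)\<bar> * \<bar>\<zeta> x\<bar> \<le> 1" using H(3) \<zeta>(2)[of x] by (intro mult_le_one) auto
      then have "norm ((s * w (c \<bullet> x) * \<zeta> x) *\<^sub>R outer a b) \<le> 1 * norm (outer a b)"
        unfolding norm_scaleR abs_mult s1 by (intro mult_right_mono) auto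
      with 1 show ?thesis unfolding jac by (intro norm_triangle_le) linarith
    qed
    show "norm (\<phi> x) \<le> 1" for x
    proof -
      have "norm (\<phi> x) = \<bar>h x\<bar> * (\<bar>\<zeta> x\<bar> * norm a)" by (simp add: \<phi>_def \<psi>_def abs_mult)
      also have "\<dots> \<le> (7 / j) * (1 * norm a)"
        using h_bd \<zeta>(2)[of x] j by (intro mult_mono) auto
      also have "\<dots> \<le> 1" using j by (simp add: field_simps)
      finally show ?thesis .
    qed
  qed
qed

section \<open>Cycles through all directions and the staircase\<close>

lemma outer_scaleR: "outer (c *\<^sub>R a) b = c *\<^sub>R outer a b"
  by (simp add: outer_def vec_eq_iff)

text \<open>Induction on the set \<open>J\<close> of directions already treated. On
  \<open>D'\<close> the coefficients in \<open>J\<close> have become 2 and the others are still 1.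
  Treating one more direction at least halves \<open>D'\<close> and, up to a small set, sends the
  discarded part to matrices with a vanishing coefficient, where \<open>f\<close> is at most
  \<open>\<gamma>\<close>. For \<open>J = I\<close> the matrix on \<open>D'\<close> is
  doubled.\<close>

lemma laminate_cycle:
  fixes a :: "'i \<Rightarrow> real^'m" and b :: "'i \<Rightarrow> real^'n" and f :: "real^'n^'m \<Rightarrow> real"
  assumes "finite I" "\<And>i. i \<in> I \<Longrightarrow> b i \<noteq> 0" "open D" "bounded D"
    and f: "\<And>c. \<exists>i\<in>I. c i = 0 \<Longrightarrow> f (\<Sum>i\<in>I. c i *\<^sub>R outer (a i) (b i)) \<le> \<gamma>"
    and "J \<subseteq> I" "\<epsilon> > 0"
  shows "\<exists>\<phi> D' E. \<phi> \<in> test_functions D \<and> open D' \<and> D' \<subseteq> D \<and>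
    measure lebesgue D' \<le> measure lebesgue D / 2 ^ card J \<and>
    E \<in> lmeasurable \<and> measure lebesgue E \<le> \<epsilon> \<and>
    (\<forall>x\<in>D'. jacobian \<phi> (at x) = (\<Sum>i\<in>J. outer (a i) (b i))) \<and>
    (\<forall>x\<in>D - D' - E. f ((\<Sum>i\<in>I. outer (a i) (b i)) + jacobian \<phi> (at x)) \<le> \<gamma>) \<and>
    (\<forall>x. norm (jacobian \<phi> (at x)) \<le> (\<Sum>i\<in>J. norm (outer (a i) (b i)) + 1)) \<and>
    (\<forall>x. norm (\<phi> x) \<le> real (card J))"
proof -
  have "finite J" using assms finite_subset by blast
  then show ?thesis using \<open>J \<subseteq> I\<close> \<open>\<epsilon> > 0\<close>
  proof (induction J arbitrary: \<epsilon> rule: finite_induct)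
    case empty
    show ?case
      by (rule exI[of _ "\<lambda>_. 0"], rule exI[of _ D], rule exI[of _ "{}"])
        (use assms empty in \<open>auto simp: test_functions_zero jacobian_eq[OF has_derivative_const] matrix_def vec_eq_iff\<close>)
  next
    case (insert i J)
    obtain \<phi> D1 E1 where 1: "\<phi> \<in> test_functions D" "open D1" "D1 \<subseteq> D"
      "measure lebesgue D1 \<le> measure lebesgue D / 2 ^ card J"
      "E1 \<in> lmeasurable" "measure lebesgue E1 \<le> \<epsilon> / 2"
      "\<And>x. x\<in>D1 \<Longrightarrow> jacobian \<phi> (at x) = (\<Sum>i\<in>J. outer (a i) (b i))"
      "\<And>x. x\<in>D - D1 - E1 \<Longrightarrow> f ((\<Sum>i\<in>I. outer (a i) (b i)) + jacobian \<phi> (at x)) \<le> \<gamma>"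
      "\<And>x. norm (jacobian \<phi> (at x)) \<le> (\<Sum>i\<in>J. norm (outer (a i) (b i)) + 1)"
      "\<And>x. norm (\<phi> x) \<le> real (card J)"
      using insert.IH[of "\<epsilon> / 2"] insert.prems by auto
    have i: "i \<in> I" "b i \<noteq> 0" using insert.prems assms by auto
    have "bounded D1" using 1 assms bounded_subset by blast
    obtain \<psi> D' A where 2: "\<psi> \<in> test_functions D1" "open D'" "open A" "D' \<subseteq> D1" "A \<subseteq> D1"
      "measure lebesgue D' \<le> measure lebesgue D1 / 2" "measure lebesgue (D1 - D' - A) \<le> \<epsilon> / 2"
      "\<And>x. x \<in> D' \<Longrightarrow> jacobian \<psi> (at x) = outer (a i) (b i)"
      "\<And>x. x \<in> A \<Longrightarrow> jacobian \<psi> (at x) = - outer (a i) (b i)"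
      "\<And>x. norm (jacobian \<psi> (at x)) \<le> norm (outer (a i) (b i)) + 1" "\<And>x. norm (\<psi> x) \<le> 1"
      using laminate_step[OF i(2) \<open>open D1\<close> \<open>bounded D1\<close>, of "\<epsilon> / 2" "a i"] insert.prems(2)
      by (metis half_gt_zero)
    \<comment> \<open>The exceptional set of the earlier directions is enlarged by the transition
      layer of the new one; each part has measure at most \<open>\<epsilon> / 2\<close>.\<close>
    define E where "E = E1 \<union> (D1 - D' - A)"
    have D1: "D1 - D' - A \<in> lmeasurable"
      using \<open>open D1\<close> \<open>bounded D1\<close> 2 by (intro fmeasurable_Diff) (auto intro: lmeasurable_open)
    note jac = jacobian_add[OF 1(1) 2(1)]
    show ?case
    proof (rule exI[of _ "\<lambda>x. \<phi> x + \<psi> x"], rule exI[of _ D'], rule exI[of _ E], intro conjI ballI allI)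
      show "(\<lambda>x. \<phi> x + \<psi> x) \<in> test_functions D"
        using 1 2 test_functions_mono[of D1 D] by (intro test_functions_add) auto
      show "open D'" "D' \<subseteq> D" using 1 2 by auto
      show "measure lebesgue D' \<le> measure lebesgue D / 2 ^ card (insert i J)"
      proof -
        have "measure lebesgue D' \<le> (measure lebesgue D / 2 ^ card J) / 2"
          by (rule order_trans[OF 2(6) divide_right_mono[OF 1(4)]]) simp
        then show ?thesis using insert.hyps by (simp add: mult.commute)
      qed
      show "E \<in> lmeasurable" using 1 D1 by (auto simp: E_def)
      have "measure lebesgue E \<le> measure lebesgue E1 + measure lebesgue (D1 - D' - A)"
        unfolding E_def by (rule measure_Un_le) (use 1 D1 in auto)
      then show "measure lebesgue E \<le> \<epsilon>" using 1 2 by linarith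
      show "jacobian (\<lambda>x. \<phi> x + \<psi> x) (at x) = (\<Sum>i\<in>insert i J. outer (a i) (b i))" if "x \<in> D'" for x
        using that 1 2 insert.hyps jac by auto
      show "norm (jacobian (\<lambda>x. \<phi> x + \<psi> x) (at x)) \<le> (\<Sum>i\<in>insert i J. norm (outer (a i) (b i)) + 1)" for x
        unfolding jac using 1(9)[of x] 2(10)[of x] insert.hyps norm_triangle_le
        by (smt (verit) norm_triangle_ineq sum.insert)
      show "norm (\<phi> x + \<psi> x) \<le> real (card (insert i J))" for x
        using 1(10)[of x] 2(11)[of x] insert.hyps norm_triangle_ineq[of "\<phi> x" "\<psi> x"] by auto
      show "f ((\<Sum>i\<in>I. outer (a i) (b i)) + jacobian (\<lambda>x. \<phi> x + \<psi> x) (at x)) \<le> \<gamma>"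
        if "x \<in> D - D' - E" for x
      proof (cases "x \<in> D1")
        case True
        then have "x \<in> A" using that by (auto simp: E_def)
        \<comment> \<open>The coefficients on \<open>A\<close>: 2 for the indices in
          \<open>J\<close>, 0 for the new index \<open>i\<close>, which is not in \<open>J\<close>,
          and 1 for all others. The zero brings the assumption on \<open>f\<close> into
          play.\<close>
        define c :: "'i \<Rightarrow> real" where "c l = 1 + (if l \<in> J then 1 else 0) - (if l = i then 1 else 0)" for l
        have "(\<Sum>l\<in>I. c l *\<^sub>R outer (a l) (b l)) = (\<Sum>l\<in>I. outer (a l) (b l))
            + (\<Sum>l\<in>I. if l \<in> J then outer (a l) (b l) else 0) - (\<Sum>l\<in>I. if l = i then outer (a l) (b l) else 0)"
          unfolding sum.distrib[symmetric] sum_subtractf[symmetric]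
          by (intro sum.cong) (auto simp: c_def algebra_simps)
        also have "(\<Sum>l\<in>I. if l \<in> J then outer (a l) (b l) else 0) = (\<Sum>l\<in>J. outer (a l) (b l))"
          using insert.prems assms(1) by (subst sum.inter_restrict[symmetric]) (auto simp: Int_absorb1)
        also have "(\<Sum>l\<in>I. if l = i then outer (a l) (b l) else 0) = outer (a i) (b i)"
          using assms(1) i by (simp add: sum.delta)
        finally have "(\<Sum>l\<in>I. c l *\<^sub>R outer (a l) (b l)) = (\<Sum>l\<in>I. outer (a l) (b l))
            + jacobian (\<lambda>x. \<phi> x + \<psi> x) (at x)"
          using 1(7)[OF True] 2(9)[OF \<open>x \<in> A\<close>] jac[of x] by simp
        then show ?thesis using f[of c] i(1) insert.hyps by (force simp: c_def)
      next
        case False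
        then show ?thesis
          using that 1(8)[of x] jac[of x] jacobian_zero_outside[OF 2(1)] by (auto simp: E_def)
      qed
    qed
  qed
qed

text \<open>Round \<open>N\<close> is a cycle started at \<open>2 ^ N *\<^sub>R C\<close> on the set
  left by the previous round. The tolerances \<open>\<epsilon> N\<close> are prescribed beforehand,
  so that they can be fitted to the size of \<open>f\<close> on the matrices reached in round
  \<open>N\<close>.\<close>

lemma staircase:
  fixes a :: "'i \<Rightarrow> real^'m" and b :: "'i \<Rightarrow> real^'n" and f :: "real^'n^'m \<Rightarrow> real"
  assumes "finite I" "\<And>i. i \<in> I \<Longrightarrow> b i \<noteq> 0" "open \<Omega>" "bounded \<Omega>"
    and f: "\<And>c. \<exists>i\<in>I. c i = 0 \<Longrightarrow> f (\<Sum>i\<in>I. c i *\<^sub>R outer (a i) (b i)) \<le> \<gamma>"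
    and C: "C = (\<Sum>i\<in>I. outer (a i) (b i))" and L: "L = (\<Sum>i\<in>I. norm (outer (a i) (b i)) + 1)"
    and \<epsilon>: "\<And>N. \<epsilon> N > 0"
  obtains \<phi> :: "nat \<Rightarrow> real^'n \<Rightarrow> real^'m" and D E where
    "D 0 = \<Omega>" "\<And>N. open (D N)" "\<And>N. D (Suc N) \<subseteq> D N"
    "\<And>N. measure lebesgue (D N) \<le> measure lebesgue \<Omega> / 2 ^ (card I * N)"
    "\<And>N. \<phi> N \<in> test_functions (D N)" "\<And>N. E N \<in> lmeasurable" "\<And>N. measure lebesgue (E N) \<le> \<epsilon> N"
    "\<And>N x. x \<in> D (Suc N) \<Longrightarrow> jacobian (\<phi> N) (at x) = 2 ^ N *\<^sub>R C"
    "\<And>N x. x \<in> D N - D (Suc N) - E N \<Longrightarrow> f (2 ^ N *\<^sub>R C + jacobian (\<phi> N) (at x)) \<le> \<gamma>"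
    "\<And>N x. norm (jacobian (\<phi> N) (at x)) \<le> 2 ^ N * L" "\<And>N x. norm (\<phi> N x) \<le> 2 ^ N * L"
proof -
  have cycle: "\<exists>\<phi> D' E. \<phi> \<in> test_functions D \<and> open D' \<and> D' \<subseteq> D \<and>
    measure lebesgue D' \<le> measure lebesgue D / 2 ^ card I \<and>
    E \<in> lmeasurable \<and> measure lebesgue E \<le> \<epsilon> N \<and>
    (\<forall>x\<in>D'. jacobian \<phi> (at x) = 2 ^ N *\<^sub>R C) \<and>
    (\<forall>x\<in>D - D' - E. f (2 ^ N *\<^sub>R C + jacobian \<phi> (at x)) \<le> \<gamma>) \<and>
    (\<forall>x. norm (jacobian \<phi> (at x)) \<le> 2 ^ N * L) \<and>
    (\<forall>x. norm (\<phi> x) \<le> 2 ^ N * L)" (is "\<exists>\<phi> D' E. ?P N D \<phi> D' E") if "open D" "bounded D" for D N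
  proof -
    \<comment> \<open>Scaling \<open>a\<close> alone scales every rank-one summand, and a vanishing
      coefficient stays a vanishing coefficient.\<close>
    let ?a = "\<lambda>i. 2 ^ N *\<^sub>R a i"
    have C': "(\<Sum>i\<in>I. outer (?a i) (b i)) = 2 ^ N *\<^sub>R C"
      by (simp add: C outer_scaleR scaleR_sum_right)
    have "f (\<Sum>i\<in>I. c i *\<^sub>R outer (?a i) (b i)) \<le> \<gamma>" if "\<exists>i\<in>I. c i = 0" for c
      using f[of "\<lambda>i. c i * 2 ^ N"] that by (simp add: outer_scaleR)
    from laminate_cycle[of I b D f ?a \<gamma>, OF assms(1,2) that this subset_refl \<epsilon>[of N]]
    obtain \<phi> D' E where *: "\<phi> \<in> test_functions D" "open D'" "D' \<subseteq> D"
      "measure lebesgue D' \<le> measure lebesgue D / 2 ^ card I"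
      "E \<in> lmeasurable" "measure lebesgue E \<le> \<epsilon> N"
      "\<And>x. x\<in>D' \<Longrightarrow> jacobian \<phi> (at x) = 2 ^ N *\<^sub>R C"
      "\<And>x. x\<in>D - D' - E \<Longrightarrow> f (2 ^ N *\<^sub>R C + jacobian \<phi> (at x)) \<le> \<gamma>"
      "\<And>x. norm (jacobian \<phi> (at x)) \<le> (\<Sum>i\<in>I. norm (outer (?a i) (b i)) + 1)"
      "\<And>x. norm (\<phi> x) \<le> real (card I)"
      unfolding C' by blast
    have 1: "(1::real) \<le> 2 ^ N" by simp
    \<comment> \<open>The added 1 in each summand is absorbed because \<open>2 ^ N\<close> is at
      least 1; it also makes \<open>L\<close> at least \<open>card I\<close>, so one constant bounds
      both the gradients and the values.\<close>
    have "(\<Sum>i\<in>I. norm (outer (?a i) (b i)) + 1) \<le> 2 ^ N * L"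
      unfolding L sum_distrib_left using 1 by (intro sum_mono) (simp add: outer_scaleR distrib_left)
    moreover have "real (card I) \<le> 2 ^ N * L"
    proof -
      have "real (card I) \<le> L" unfolding L by (simp add: sum.distrib sum_nonneg)
      also have "\<dots> \<le> 2 ^ N * L" using 1 mult_right_mono[OF 1, of L] \<open>real (card I) \<le> L\<close> by simp
      finally show ?thesis .
    qed
    ultimately have "?P N D \<phi> D' E" using * order_trans by blast
    then show ?thesis by blast
  qed
  \<comment> \<open>A round depends on the earlier ones only through its set \<open>D\<close>.
    Choosing the triple as a function of \<open>N\<close> and \<open>D\<close> reduces the
    construction to a primitive recursion for the sets.\<close>
  define Q where "Q N D = (\<lambda>(\<phi>, D', E). ?P N D \<phi> D' E)" for N D
  have "\<exists>t. Q N D t" if "open D" "bounded D" for N D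
    using cycle[OF that, of N] unfolding Q_def by (simp add: split_paired_Ex)
  then have Q: "Q N D (SOME t. Q N D t)" if "open D" "bounded D" for N D
    using that by (blast intro: someI_ex)
  define \<Phi> where "\<Phi> N D = fst (SOME t. Q N D t)" for N D
  define \<D> where "\<D> N D = fst (snd (SOME t. Q N D t))" for N D
  define \<E> where "\<E> N D = snd (snd (SOME t. Q N D t))" for N D
  have *: "?P N D (\<Phi> N D) (\<D> N D) (\<E> N D)" if "open D" "bounded D" for N D
  proof -
    have "?P N D (fst t) (fst (snd t)) (snd (snd t))" if "Q N D t" for t
      using that unfolding Q_def case_prod_beta .
    then show ?thesis unfolding \<Phi>_def \<D>_def \<E>_def using Q[OF that] by blast
  qed
  define D where "D = rec_nat \<Omega> \<D>"
  have D[simp]: "D 0 = \<Omega>" "D (Suc N) = \<D> N (D N)" for N by (simp_all add: D_def)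
  have ob: "open (D N) \<and> bounded (D N)" for N
  proof (induction N)
    case (Suc N)
    then have "open (\<D> N (D N))" "\<D> N (D N) \<subseteq> D N" using *[of "D N" N] by auto
    then show ?case using Suc bounded_subset by auto
  qed (use assms in simp)
  have P: "?P N (D N) (\<Phi> N (D N)) (D (Suc N)) (\<E> N (D N))" for N
    unfolding D(2) using *[of "D N" N] ob[of N] by blast
  have m: "measure lebesgue (D N) \<le> measure lebesgue \<Omega> / 2 ^ (card I * N)" for N
  proof (induction N)
    case (Suc N)
    have "measure lebesgue (D (Suc N)) \<le> measure lebesgue (D N) / 2 ^ card I" using P[of N] by blast
    also have "\<dots> \<le> measure lebesgue \<Omega> / 2 ^ (card I * N) / 2 ^ card I"
      by (intro divide_right_mono Suc) simp
    finally show ?case by (simp add: power_add mult.commute)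
  qed simp
  show ?thesis
    by (rule that[of D "\<lambda>N. \<Phi> N (D N)" "\<lambda>N. \<E> N (D N)"]) (use ob m P in \<open>blast | simp\<close>)+
qed

section \<open>Passing to the limit\<close>

text \<open>Difference quotients have integral zero by translation invariance, and they converge
  dominatedly to the directional derivative.\<close>

lemma integral_test_function_derivative:
  fixes h :: "'a::euclidean_space \<Rightarrow> real"
  assumes h: "h \<in> test_functions D"
  shows "(\<integral>x. frechet_derivative h (at x) v \<partial>lborel) = 0"
proof -
  obtain K where K: "compact K" "\<And>x. x \<notin> K \<Longrightarrow> h x = 0"
    using test_functionsE[OF h] by metis
  obtain R where R: "R > 0" "\<And>x. x \<in> K \<Longrightarrow> norm x \<le> R"
    using compact_imp_bounded[OF K(1)] by (auto simp: bounded_pos)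
  obtain M where M: "\<And>x. norm (frechet_derivative h (at x) v) \<le> M"
    using test_function_bounded[OF test_functions_derivative[OF h, of v]] by metis
  \<comment> \<open>Steps of size at most 1 keep all difference quotients supported in the ball of
    radius \<open>R + norm v\<close>.\<close>
  define t where "t n = inverse (real (Suc n))" for n
  define s where "s n x = (h (x + t n *\<^sub>R v) - h x) / t n" for n x
  have t: "0 < t n" "t n \<le> 1" for n
    by (simp_all add: t_def field_simps)
  have cont: "continuous_on UNIV h" by (rule test_function_continuous[OF h])
  have meas[measurable]: "h \<in> borel_measurable borel"
    by (rule borel_measurable_continuous_onI[OF cont])
  have hint: "integrable lborel h"
  proof -
    have "integrable lborel (\<lambda>x. indicator K x *\<^sub>R h x)"
      by (rule borel_integrable_compact[OF K(1)]) (rule continuous_on_subset[OF cont], simp)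
    also have "(\<lambda>x. indicator K x *\<^sub>R h x) = h" using K(2) by (auto simp: indicator_def fun_eq_iff)
    finally show ?thesis .
  qed
  have shift: "(\<lambda>x. h (x + c)) = (\<lambda>x. h (c + x))" for c by (simp add: add.commute)
  have hint': "integrable lborel (\<lambda>x. h (x + c))" for c
    using hint integrable_distr_eq[of "(+) c" lborel borel h] by (simp add: lborel_distr_plus shift)
  have inteq: "(\<integral>x. h (x + c) \<partial>lborel) = (\<integral>x. h x \<partial>lborel)" for c
    using integral_distr[of "(+) c" lborel borel h] by (simp add: lborel_distr_plus shift)
  have s0: "(\<integral>x. s n x \<partial>lborel) = 0" for n
    unfolding s_def using hint hint' inteq by simp
  have line: "((\<lambda>r. h (x + r *\<^sub>R v)) has_real_derivative frechet_derivative h (at (x + r *\<^sub>R v)) v) (at r)" for x r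
  proof -
    have "((\<lambda>r. x + r *\<^sub>R v) has_derivative (\<lambda>r. r *\<^sub>R v)) (at r)"
      by (auto intro!: derivative_eq_intros)
    from has_derivative_compose[OF this test_function_has_derivative[OF h]]
    show ?thesis
      unfolding has_field_derivative_def
      using linear_scale[OF has_derivative_linear[OF test_function_has_derivative[OF h]]]
      by (simp add: mult_commute_abs)
  qed
  have "(\<lambda>n. \<integral>x. s n x \<partial>lborel) \<longlonglongrightarrow> (\<integral>x. frechet_derivative h (at x) v \<partial>lborel)"
  proof (rule integral_dominated_convergence[where w = "\<lambda>x. M * indicator (cball 0 (R + norm v)) x"])
    show "(\<lambda>x. frechet_derivative h (at x) v) \<in> borel_measurable lborel"
      using borel_measurable_continuous_onI[OF test_function_continuous[OF test_functions_derivative[OF h]]] by simp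
    show "s n \<in> borel_measurable lborel" for n
      unfolding s_def by measurable
    show "integrable lborel (\<lambda>x. M * indicator (cball 0 (R + norm v)) x)"
      by (intro integrable_mult_right integrable_real_indicator) (use emeasure_bounded_finite[OF bounded_cball] in auto)
    show "AE x in lborel. (\<lambda>n. s n x) \<longlonglongrightarrow> frechet_derivative h (at x) v"
    proof (rule AE_I2)
      fix x
      have "((\<lambda>r. (h (x + r *\<^sub>R v) - h x) / r) \<longlongrightarrow> frechet_derivative h (at x) v) (at 0)"
        using line[of x 0] by (simp add: DERIV_def)
      moreover have "filterlim t (at 0) sequentially"
      proof (rule filterlim_atI)
        show "t \<longlonglongrightarrow> 0" unfolding t_def[abs_def] by (rule LIMSEQ_inverse_real_of_nat)
        show "\<forall>\<^sub>F n in sequentially. t n \<noteq> 0" using t(1) by (simp add: less_imp_neq[symmetric])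
      qed
      ultimately show "(\<lambda>n. s n x) \<longlonglongrightarrow> frechet_derivative h (at x) v"
        unfolding s_def by (rule filterlim_compose)
    qed
    show "AE x in lborel. norm (s n x) \<le> M * indicator (cball 0 (R + norm v)) x" for n
    proof (rule AE_I2)
      fix x
      have "norm (h (x + t n *\<^sub>R v) - h (x + 0 *\<^sub>R v)) \<le> M * norm (t n - 0)"
        by (rule field_differentiable_bound[OF convex_UNIV line M]) auto
      then have b: "norm (s n x) \<le> M" using t(1)[of n] by (simp add: s_def field_simps)
      show "norm (s n x) \<le> M * indicator (cball 0 (R + norm v)) x"
      proof (cases "norm x \<le> R + norm v")
        case True
        then show ?thesis using b by simp
      next
        case False
        have "norm (t n *\<^sub>R v) \<le> norm v" using t[of n] by (simp add: mult_left_le_one_le)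
        then have "R < norm (x + t n *\<^sub>R v)" using False norm_diff_ineq[of x "t n *\<^sub>R v"] by linarith
        moreover have "R < norm x" using False norm_ge_zero[of v] by linarith
        ultimately have "h (x + t n *\<^sub>R v) = 0" "h x = 0" using K(2) R(2) by (meson not_less)+
        then show ?thesis using False by (simp add: s_def)
      qed
    qed
  qed
  then show ?thesis by (simp add: s0 LIMSEQ_const_iff)
qed

text \<open>The product of a component of \<open>\<phi>\<close> with \<open>\<psi>\<close> is a test
  function, so its partial derivative has integral zero; the product rule splits it into the two
  integrands.\<close>

lemma integration_by_parts_test_functions:
  fixes \<phi> :: "real^'n \<Rightarrow> real^'m" and \<psi> :: "real^'n \<Rightarrow> real"
  assumes "open \<Omega>" and \<phi>: "\<phi> \<in> test_functions \<Omega>" and \<psi>: "\<psi> \<in> test_functions \<Omega>"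
  shows "(\<integral>x. \<phi> x $ i * frechet_derivative \<psi> (at x) (axis j 1) \<partial>lebesgue_on \<Omega>)
    = - (\<integral>x. jacobian \<phi> (at x) $ i $ j * \<psi> x \<partial>lebesgue_on \<Omega>)"
proof -
  let ?v = "axis j 1 :: real^'n"
  let ?f = "\<lambda>x. \<phi> x $ i * frechet_derivative \<psi> (at x) ?v" and ?g = "\<lambda>x. jacobian \<phi> (at x) $ i $ j * \<psi> x"
  have der: "((\<lambda>x. \<phi> x $ i) has_derivative (\<lambda>v. frechet_derivative \<phi> (at x) v $ i)) (at x)" for x
    by (rule bounded_linear.has_derivative[OF bounded_linear_vec_nth test_function_has_derivative[OF \<phi>]])
  obtain K where K: "\<And>k. Ck k \<phi>" "compact K" "K \<subseteq> \<Omega>" "\<And>x. x \<notin> K \<Longrightarrow> \<phi> x = 0"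
    using test_functionsE[OF \<phi>] by metis
  have \<phi>K: "\<phi> \<in> test_functions K" using K by (intro test_functionsI[of \<phi> K]) auto
  have Ck\<phi>: "Ck k (\<lambda>x. \<phi> x $ i)" for k
    using K(1)[of k]
  proof (induction k arbitrary: \<phi>)
    case 0
    then show ?case by (simp add: continuous_on_component)
  next
    case (Suc k)
    show ?case
      by (rule Ck_SucI[OF bounded_linear.has_derivative[OF bounded_linear_vec_nth Ck_Suc_has_derivative[OF Suc.prems]]])
        (use Suc in simp)
  qed
  have Ck\<psi>: "Ck k \<psi>" for k using \<psi> by (simp add: test_functions_def)
  have h: "(\<lambda>x. \<phi> x $ i * \<psi> x) \<in> test_functions \<Omega>"
    by (rule test_functionsI[OF Ck_mult[OF Ck\<phi> Ck\<psi>] K(2,3)]) (simp add: K(4))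
  have "frechet_derivative (\<lambda>x. \<phi> x $ i * \<psi> x) (at x) ?v = ?f x + ?g x" for x
    unfolding frechet_derivative_at[OF has_derivative_mult[OF der test_function_has_derivative[OF \<psi>]], symmetric]
    by (simp only: jacobian_component)
  then have sum0: "(\<integral>x. ?f x + ?g x \<partial>lborel) = 0"
    using integral_test_function_derivative[OF h, of ?v] by simp
  have cf: "continuous_on UNIV ?f"
    by (intro continuous_intros test_function_continuous[OF \<phi>]
        test_function_continuous[OF test_functions_derivative[OF \<psi>]])
  have cg: "continuous_on UNIV ?g"
    by (intro continuous_intros continuous_on_jacobian[OF \<phi>] test_function_continuous[OF \<psi>])
  have zero: "?f x = 0" "?g x = 0" if "x \<notin> K" for x
    using that K(4) jacobian_zero_outside[OF \<phi>K that] by auto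
  have int: "integrable lborel u" if "continuous_on UNIV u" "\<And>x. x \<notin> K \<Longrightarrow> u x = 0" for u :: "real^'n \<Rightarrow> real"
  proof -
    have "integrable lborel (\<lambda>x. indicator K x *\<^sub>R u x)"
      by (rule borel_integrable_compact[OF K(2)]) (rule continuous_on_subset[OF that(1)], simp)
    also have "(\<lambda>x. indicator K x *\<^sub>R u x) = u" using that(2) by (auto simp: indicator_def fun_eq_iff)
    finally show ?thesis .
  qed
  \<comment> \<open>Continuous integrands that vanish off a compact subset of
    \<open>\<Omega>\<close> have the same integral over \<open>\<Omega>\<close> for the completed
    measure as over the whole space for \<open>lborel\<close>.\<close>
  have leb: "(\<integral>x. u x \<partial>lebesgue_on \<Omega>) = (\<integral>x. u x \<partial>lborel)"
    if "continuous_on UNIV u" "\<And>x. x \<notin> K \<Longrightarrow> u x = 0" for u :: "real^'n \<Rightarrow> real"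
  proof -
    have "(\<integral>x. u x \<partial>lebesgue_on \<Omega>) = (\<integral>x. indicator \<Omega> x *\<^sub>R u x \<partial>lebesgue)"
      using assms(1) by (intro integral_restrict_space) auto
    also have "(\<lambda>x. indicator \<Omega> x *\<^sub>R u x) = u"
      using that(2) K(3) by (auto simp: indicator_def fun_eq_iff)
    also have "(\<integral>x. u x \<partial>lebesgue) = (\<integral>x. u x \<partial>lborel)"
      using borel_measurable_continuous_onI[OF that(1)] by (intro integral_completion) simp
    finally show ?thesis .
  qed
  have "(\<integral>x. ?f x \<partial>lborel) + (\<integral>x. ?g x \<partial>lborel) = 0"
    using sum0 Bochner_Integration.integral_add[OF int[OF cf zero(1)] int[OF cg zero(2)]] by simp
  then show ?thesis
    using leb[OF cf zero(1)] leb[OF cg zero(2)] by linarith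
qed

text \<open>The sum has finitely many terms off the null set \<open>\<Inter>N. D N\<close>; on that set the index set is
  infinite and the value is the junk value \<open>0\<close>.\<close>

definition stair_sum :: "(nat \<Rightarrow> 'a set) \<Rightarrow> (nat \<Rightarrow> 'a \<Rightarrow> 'b::comm_monoid_add) \<Rightarrow> 'a \<Rightarrow> 'b" where
  "stair_sum D g x = (\<Sum>M | x \<in> D M. g M x)"

section \<open>Sums over a shrinking sequence of open sets\<close>

text \<open>In the application \<open>r\<close> is the number of rank-one summands: a round halves
  the set at least once for each of them.\<close>

locale shrinking_sets =
  fixes D :: "nat \<Rightarrow> 'a::euclidean_space set" and r :: nat
  assumes D_open: "\<And>N. open (D N)" and D_bounded: "bounded (D 0)"
    and D_Suc: "\<And>N. D (Suc N) \<subseteq> D N"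
    and D_measure: "\<And>N. measure lebesgue (D N) \<le> measure lebesgue (D 0) / 2 ^ (r * N)"
    and r_pos: "r > 0"
begin

abbreviation "\<M> \<equiv> lebesgue_on (D 0)"

lemma D_decseq: "decseq D"
  using D_Suc by (simp add: decseq_Suc_iff)

lemma D_subset: "D N \<subseteq> D 0"
  using decseqD[OF D_decseq, of 0 N] by simp

lemma D_lmeasurable: "D N \<in> lmeasurable"
  by (intro lmeasurable_open bounded_subset[OF D_bounded D_subset] D_open)

lemma D0_sets: "D 0 \<inter> space lebesgue \<in> sets lebesgue"
  using D_lmeasurable[of 0] by auto

lemma D_sets_M: "D N \<in> sets \<M>"
  using D_lmeasurable[of N] D_subset[of N] D_lmeasurable[of 0] by (simp add: sets_restrict_space_iff)

lemma measure_M: "measure \<M> (D N) = measure lebesgue (D N)"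
  by (rule measure_restrict_space[OF D0_sets D_subset])

lemma negligible_Inter: "negligible (\<Inter>N. D N)"
proof -
  have "measure lebesgue (\<Inter>N. D N) \<le> measure lebesgue (D 0) * (1/2) ^ N" for N
  proof -
    have "measure lebesgue (\<Inter>N. D N) \<le> measure lebesgue (D N)"
      using D_lmeasurable by (intro measure_mono_fmeasurable) auto
    also have "\<dots> \<le> measure lebesgue (D 0) / 2 ^ (r * N)" by (rule D_measure)
    also have "\<dots> \<le> measure lebesgue (D 0) / 2 ^ N"
      using r_pos by (intro divide_left_mono power_increasing) auto
    finally show ?thesis by (simp add: power_one_over field_simps)
  qed
  moreover have "(\<lambda>N. measure lebesgue (D 0) * (1/2) ^ N) \<longlonglongrightarrow> measure lebesgue (D 0) * 0"
    by (intro tendsto_mult tendsto_const LIMSEQ_power_zero) simp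
  ultimately have "measure lebesgue (\<Inter>N. D N) \<le> 0"
    by (intro LIMSEQ_le_const[of "\<lambda>N. measure lebesgue (D 0) * (1/2) ^ N"]) auto
  moreover have "(\<Inter>N. D N) \<in> lmeasurable"
    using D_lmeasurable by (intro fmeasurableI2[OF D_lmeasurable[of 0]]) auto
  ultimately show ?thesis
    by (simp add: negligible_iff_measure measure_le_0_iff)
qed

text \<open>The sets are nested, so off their null intersection a point lies in exactly the first
  \<open>K\<close> of them. The pointwise estimates below work with this level
  \<open>K\<close>.\<close>

lemma AE_level: "AE x in \<M>. \<exists>K. \<forall>M. x \<in> D M \<longleftrightarrow> M < K"
proof -
  have level: "\<exists>K. \<forall>M. x \<in> D M \<longleftrightarrow> M < K" if x: "x \<notin> (\<Inter>N. D N)" for x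
  proof -
    define K where "K = (LEAST K. x \<notin> D K)"
    have "x \<notin> D K" unfolding K_def using x LeastI_ex[of "\<lambda>K. x \<notin> D K"] by auto
    then have "x \<notin> D M" if "M \<ge> K" for M using decseqD[OF D_decseq that] by blast
    moreover have "x \<in> D M" if "M < K" for M
      using that not_less_Least[of M "\<lambda>K. x \<notin> D K"] by (auto simp: K_def)
    ultimately show ?thesis by (meson not_le)
  qed
  have "AE x in lebesgue. x \<notin> (\<Inter>N. D N)"
    using negligible_Inter by (intro AE_not_in) (simp add: negligible_iff_null_sets)
  then show ?thesis
    unfolding AE_restrict_space_iff[OF D0_sets] by eventually_elim (use level in blast)
qed

text \<open>At a point of exactly the first \<open>k + 1\<close> sets, terms of size at most
  \<open>2 ^ M * L\<close> add up to at most \<open>2 ^ Suc k * L\<close>, whose power is a single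
  term of this series. One function thus dominates partial sums, their limit and the tails.\<close>

definition dominator :: "real \<Rightarrow> real \<Rightarrow> 'a \<Rightarrow> real" where
  "dominator L q x = (\<Sum>i. (2 ^ Suc i * L) powr q * indicator (D i) x)"

lemma dominator_summable:
  assumes "\<forall>M. x \<in> D M \<longleftrightarrow> M < K"
  shows "summable (\<lambda>i. (2 ^ Suc i * L) powr q * indicator (D i) x :: real)"
  by (rule summable_finite[of "{..<K}"]) (use assms in auto)

text \<open>The growth \<open>2 powr (q * i)\<close> of the terms loses against the decay
  \<open>2 ^ (r * i)\<close> of the measures: the integrals are bounded by a geometric series of
  ratio \<open>2 powr (q - r)\<close>, which is below 1 since \<open>q < r\<close>.\<close>

lemma dominator_integrable:
  assumes "0 \<le> L" "0 \<le> q" "q < real r"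
  shows "integrable \<M> (dominator L q)"
  unfolding dominator_def[abs_def]
proof (rule integrable_suminf)
  have fin: "emeasure \<M> (D i) < \<infinity>" for i
    unfolding emeasure_restrict_space[OF D0_sets D_subset[of i]]
    using fmeasurableD2[OF D_lmeasurable[of i]] by (simp only: infinity_ennreal_def less_top)
  show int: "integrable \<M> (\<lambda>x. (2 ^ Suc i * L) powr q * indicator (D i) x :: real)" for i
    by (intro integrable_mult_right integrable_real_indicator D_sets_M fin)
  show "AE x in \<M>. summable (\<lambda>i. norm ((2 ^ Suc i * L) powr q * indicator (D i) x :: real))"
    using AE_level
  proof eventually_elim
    case (elim x)
    then obtain K where "\<forall>M. x \<in> D M \<longleftrightarrow> M < K" ..
    from dominator_summable[OF this, of L q] show ?case by (simp add: abs_mult)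
  qed
  define \<theta> where "\<theta> = 2 powr (q - real r)"
  have \<theta>: "0 \<le> \<theta>" "\<theta> < 1" using assms by (auto simp: \<theta>_def powr_less_one)
  have "summable (\<lambda>i. (2 * L) powr q * measure lebesgue (D 0) * \<theta> ^ i)"
    using \<theta> by (intro summable_mult summable_geometric) auto
  then show "summable (\<lambda>i. \<integral>x. norm ((2 ^ Suc i * L) powr q * indicator (D i) x :: real) \<partial>\<M>)"
  proof (rule summable_comparison_test')
    fix i :: nat
    have a: "(2 ^ Suc i * L) powr q = (2 * L) powr q * 2 powr (q * real i)"
    proof -
      have "(2 ^ Suc i * L) powr q = ((2 * L) * 2 ^ i) powr q" by (simp add: mult_ac)
      also have "\<dots> = (2 * L) powr q * (2 ^ i) powr q" using assms by (intro powr_mult)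
      also have "(2 ^ i :: real) powr q = 2 powr (q * real i)"
        by (subst powr_realpow[symmetric]) (simp_all add: powr_powr mult.commute)
      finally show ?thesis .
    qed
    have b: "2 powr (q * real i) / 2 ^ (r * i) = \<theta> ^ i"
    proof -
      have "\<theta> ^ i = 2 powr ((q - real r) * real i)"
        by (simp add: \<theta>_def powr_power mult.commute)
      also have "\<dots> = 2 powr (q * real i) / 2 powr (real (r * i))"
        by (simp add: left_diff_distrib powr_diff)
      also have "2 powr (real (r * i)) = 2 ^ (r * i)" by (rule powr_realpow) simp
      finally show ?thesis by simp
    qed
    have "(\<integral>x. norm ((2 ^ Suc i * L) powr q * indicator (D i) x :: real) \<partial>\<M>)
        = (\<integral>x. (2 ^ Suc i * L) powr q * indicator (D i) x \<partial>\<M>)"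
      by (simp only: real_norm_def abs_mult abs_of_nonneg powr_ge_zero indicator_pos_le)
    also have "\<dots> = (2 ^ Suc i * L) powr q * measure \<M> (D i \<inter> space \<M>)"
      by (simp only: integral_mult_right_zero Bochner_Integration.integral_indicator)
    also have "D i \<inter> space \<M> = D i" using D_subset[of i] by (auto simp: space_restrict_space)
    finally have c: "(\<integral>x. norm ((2 ^ Suc i * L) powr q * indicator (D i) x :: real) \<partial>\<M>)
        = (2 ^ Suc i * L) powr q * measure lebesgue (D i)"
      unfolding measure_M .
    have "(2 ^ Suc i * L) powr q * measure lebesgue (D i) \<le>
        (2 ^ Suc i * L) powr q * (measure lebesgue (D 0) / 2 ^ (r * i))"
      by (intro mult_left_mono D_measure) simp
    also have "\<dots> = (2 * L) powr q * measure lebesgue (D 0) * \<theta> ^ i"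
      unfolding a b[symmetric] by simp
    finally show "norm (\<integral>x. norm ((2 ^ Suc i * L) powr q * indicator (D i) x :: real) \<partial>\<M>)
        \<le> (2 * L) powr q * measure lebesgue (D 0) * \<theta> ^ i"
      unfolding c by simp
  qed
qed

text \<open>The index set \<open>A\<close> is any set of indices below the level, so that the
  estimate serves partial sums, the full sum and their difference alike.\<close>

lemma stair_bound:
  assumes "\<forall>M. x \<in> D M \<longleftrightarrow> M < K" and g: "\<And>M. norm (g M x) \<le> 2 ^ M * L" and "0 \<le> q"
    and A: "A \<subseteq> {..<K}"
  shows "norm (\<Sum>M\<in>A. g M x) powr q \<le> dominator L q x"
proof -
  have L: "0 \<le> L" using order_trans[OF norm_ge_zero g[of 0]] by simp
  have dnn: "0 \<le> dominator L q x"
    unfolding dominator_def by (intro suminf_nonneg dominator_summable[OF assms(1)]) simp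
  show ?thesis
  proof (cases K)
    case 0
    \<comment> \<open>The sum is empty, and \<open>0 powr q\<close> is 0 by convention even for
      \<open>q = 0\<close>.\<close>
    then show ?thesis using A dnn by auto
  next
    case (Suc k)
    have "norm (\<Sum>M\<in>A. g M x) \<le> (\<Sum>M\<in>A. 2 ^ M * L)"
      by (rule sum_norm_le) (rule g)
    also have "\<dots> \<le> (\<Sum>M<K. 2 ^ M * L)"
      by (rule sum_mono2) (use A L in auto)
    also have "\<dots> = (2 ^ K - 1) * L"
      by (induction K) (simp_all add: algebra_simps)
    also have "\<dots> \<le> 2 ^ Suc k * L" using L Suc by (simp add: algebra_simps)
    finally have "norm (\<Sum>M\<in>A. g M x) powr q \<le> (2 ^ Suc k * L) powr q"
      using \<open>0 \<le> q\<close> by (intro powr_mono2) auto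
    also have "\<dots> = (\<Sum>i\<in>{k}. (2 ^ Suc i * L) powr q * indicator (D i) x)"
      using assms(1) Suc by simp
    also have "\<dots> \<le> dominator L q x"
      unfolding dominator_def by (intro sum_le_suminf dominator_summable[OF assms(1)]) auto
    finally show ?thesis .
  qed
qed

lemma stair_sum_level:
  assumes "\<forall>M. x \<in> D M \<longleftrightarrow> M < K"
  shows "stair_sum D g x = (\<Sum>M<K. g M x)"
proof -
  have "{M. x \<in> D M} = {..<K}" using assms by auto
  then show ?thesis by (simp add: stair_sum_def)
qed

end

text \<open>Instantiated both with the maps and with their Jacobians, so that values and gradients
  converge by one argument.\<close>

locale stair_functions = shrinking_sets D r
  for D :: "nat \<Rightarrow> 'a::euclidean_space set" and r :: nat +
  fixes g :: "nat \<Rightarrow> 'a \<Rightarrow> 'b::euclidean_space" and L :: real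
  assumes g_cont: "\<And>N. continuous_on UNIV (g N)"
    and g_zero: "\<And>N x. x \<notin> D N \<Longrightarrow> g N x = 0"
    and g_bound: "\<And>N x. norm (g N x) \<le> 2 ^ N * L"
begin

lemma L_nonneg: "0 \<le> L"
  using order_trans[OF norm_ge_zero g_bound[of 0]] by simp

lemma partial_sum_level:
  assumes "\<forall>M. x \<in> D M \<longleftrightarrow> M < K"
  shows "(\<Sum>M<N. g M x) = (\<Sum>M<min N K. g M x)"
  by (rule sum.mono_neutral_right) (use assms g_zero in auto)

lemma partial_sum_measurable: "(\<lambda>x. \<Sum>M<N. g M x) \<in> borel_measurable \<M>"
proof -
  have "(\<lambda>x. \<Sum>M<N. g M x) \<in> borel_measurable borel"
    by (intro borel_measurable_continuous_onI continuous_on_sum g_cont)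
  then show ?thesis
    by (intro measurable_restrict_space1 measurable_completion) simp
qed

lemma partial_sum_tendsto: "AE x in \<M>. (\<lambda>N. \<Sum>M<N. g M x) \<longlonglongrightarrow> stair_sum D g x"
  using AE_level
proof eventually_elim
  case (elim x)
  then obtain K where K: "\<forall>M. x \<in> D M \<longleftrightarrow> M < K" ..
  have "(\<Sum>M<N. g M x) = stair_sum D g x" if "N \<ge> K" for N
    using that partial_sum_level[OF K, of N] by (simp add: stair_sum_level[OF K] min_absorb2)
  then show ?case by (intro tendsto_eventually) (auto simp: eventually_sequentially)
qed

text \<open>Partial sums that are reset to 0 on the intersection of all \<open>D N\<close> converge
  at every point: on that intersection the default value 0 of a sum over an infinite set is their
  limit, elsewhere they are eventually constant.\<close>

lemma stair_sum_measurable: "stair_sum D g \<in> borel_measurable \<M>"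
proof (rule borel_measurable_LIMSEQ_metric)
  have I: "(\<Inter>N. D N) \<in> sets \<M>"
    using D_sets_M by (intro sets.countable_INT) auto
  show "(\<lambda>x. if x \<in> (\<Inter>N. D N) then 0 else \<Sum>M<i. g M x) \<in> borel_measurable \<M>" for i
    using partial_sum_measurable[of i] I by (intro measurable_If_set) (auto simp: space_restrict_space Int_absorb1)
  fix x
  show "(\<lambda>i. if x \<in> (\<Inter>N. D N) then 0 else \<Sum>M<i. g M x) \<longlonglongrightarrow> stair_sum D g x"
  proof (cases "x \<in> (\<Inter>N. D N)")
    case True
    then have "{M. x \<in> D M} = UNIV" by auto
    then show ?thesis using True by (simp add: stair_sum_def)
  next
    case False
    then obtain N where N: "x \<notin> D N" by auto
    have "(\<Sum>M<i. g M x) = stair_sum D g x" if "i \<ge> N" for i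
      unfolding stair_sum_def
    proof (rule sum.mono_neutral_right)
      show "{M. x \<in> D M} \<subseteq> {..<i}"
      proof (rule ccontr)
        assume "\<not> ?thesis"
        then obtain M where M: "x \<in> D M" "N \<le> M" using \<open>N \<le> i\<close> by force
        then show False using decseqD[OF D_decseq M(2)] N by blast
      qed
    qed (use g_zero in auto)
    then show ?thesis
      using False by (intro tendsto_eventually) (auto simp: eventually_sequentially)
  qed
qed

lemma partial_sum_bound:
  assumes "0 \<le> q"
  shows "AE x in \<M>. norm (\<Sum>M<N. g M x) powr q \<le> dominator L q x"
  using AE_level
proof eventually_elim
  case (elim x)
  then obtain K where K: "\<forall>M. x \<in> D M \<longleftrightarrow> M < K" ..
  then show ?case
    by (subst partial_sum_level[OF K]) (intro stair_bound[OF K] g_bound assms, auto)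
qed

lemma stair_sum_bound:
  assumes "0 \<le> q"
  shows "AE x in \<M>. norm (stair_sum D g x) powr q \<le> dominator L q x"
  using AE_level
proof eventually_elim
  case (elim x)
  then obtain K where K: "\<forall>M. x \<in> D M \<longleftrightarrow> M < K" ..
  then show ?case
    unfolding stair_sum_level[OF K] by (intro stair_bound[OF K] g_bound assms) auto
qed

lemma stair_sum_powr_integrable:
  assumes "0 \<le> q" "q < real r"
  shows "integrable \<M> (\<lambda>x. norm (stair_sum D g x) powr q)"
proof (rule Bochner_Integration.integrable_bound[OF dominator_integrable[OF L_nonneg assms]])
  show "(\<lambda>x. norm (stair_sum D g x) powr q) \<in> borel_measurable \<M>"
    using stair_sum_measurable by measurable
  show "AE x in \<M>. norm (norm (stair_sum D g x) powr q) \<le> norm (dominator L q x)"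
    using stair_sum_bound[OF assms(1)] by eventually_elim auto
qed

lemma stair_sum_integrable:
  assumes "1 < r"
  shows "integrable \<M> (stair_sum D g)"
proof -
  have "integrable \<M> (\<lambda>x. norm (stair_sum D g x))"
    using stair_sum_powr_integrable[of 1] assms by simp
  then show ?thesis by (rule integrable_norm_cancel) (rule stair_sum_measurable)
qed

lemma stair_sum_Lp_limit:
  assumes "0 < q" "q < real r"
  shows "(\<lambda>N. \<integral>x. norm ((\<Sum>M<N. g M x) - stair_sum D g x) powr q \<partial>\<M>) \<longlonglongrightarrow> 0"
proof -
  have "(\<lambda>N. \<integral>x. norm ((\<Sum>M<N. g M x) - stair_sum D g x) powr q \<partial>\<M>) \<longlonglongrightarrow> (\<integral>x. 0 \<partial>\<M>)"
  proof (rule integral_dominated_convergence[where w = "dominator L q"])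
    show "integrable \<M> (dominator L q)" using assms by (intro dominator_integrable L_nonneg) auto
    show "(\<lambda>x. norm ((\<Sum>M<N. g M x) - stair_sum D g x) powr q) \<in> borel_measurable \<M>" for N
      using stair_sum_measurable partial_sum_measurable[of N] by measurable
    show "AE x in \<M>. (\<lambda>N. norm ((\<Sum>M<N. g M x) - stair_sum D g x) powr q) \<longlonglongrightarrow> 0"
      using partial_sum_tendsto
    proof eventually_elim
      case (elim x)
      then have "(\<lambda>N. norm ((\<Sum>M<N. g M x) - stair_sum D g x)) \<longlonglongrightarrow> 0"
        by (simp add: LIM_zero tendsto_norm_zero)
      then show ?case
        using assms by (intro tendsto_zero_powrI[where b = q]) auto
    qed
    show "AE x in \<M>. norm (norm ((\<Sum>M<N. g M x) - stair_sum D g x) powr q) \<le> dominator L q x" for N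
      using AE_level
    proof eventually_elim
      case (elim x)
      then obtain K where K: "\<forall>M. x \<in> D M \<longleftrightarrow> M < K" ..
      \<comment> \<open>Up to sign the difference is the sum over the indices from
        \<open>min N K\<close> up to, but excluding, \<open>K\<close>, to which
        \<open>stair_bound\<close> applies.\<close>
      have "(\<Sum>M<K. g M x) = (\<Sum>M\<in>{..<K} - {..<min N K}. g M x) + (\<Sum>M<min N K. g M x)"
        by (rule sum.subset_diff) auto
      then have "(\<Sum>M<N. g M x) - stair_sum D g x = - (\<Sum>M\<in>{..<K} - {..<min N K}. g M x)"
        by (subst partial_sum_level[OF K]) (simp only: stair_sum_level[OF K], simp)
      then have "norm ((\<Sum>M<N. g M x) - stair_sum D g x) powr q = norm (\<Sum>M\<in>{..<K} - {..<min N K}. g M x) powr q"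
        by simp
      also have "\<dots> \<le> dominator L q x"
        using assms by (intro stair_bound[OF K] g_bound) auto
      finally show ?case by simp
    qed
  qed simp
  then show ?thesis by simp
qed

text \<open>\<open>F\<close> stands for the pairing of a component with a test function or with its
  derivative. The linear bound in \<open>y\<close> makes \<open>B * dominator L 1\<close> an
  integrable majorant.\<close>

lemma stair_sum_integral_limit:
  fixes F :: "'a \<Rightarrow> 'b \<Rightarrow> real"
  assumes "1 < r" and F: "\<And>x y. \<bar>F x y\<bar> \<le> B * norm y" "0 \<le> B"
    and F_cont: "continuous_on UNIV (\<lambda>(x, y). F x y)"
  shows "(\<lambda>N. \<integral>x. F x (\<Sum>M<N. g M x) \<partial>\<M>) \<longlonglongrightarrow> (\<integral>x. F x (stair_sum D g x) \<partial>\<M>)"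
proof (rule integral_dominated_convergence[where w = "\<lambda>x. B * dominator L 1 x"])
  have Fm: "(\<lambda>x. F x (u x)) \<in> borel_measurable \<M>" if "u \<in> borel_measurable \<M>" for u
  proof -
    have id: "(\<lambda>x. x) \<in> borel_measurable \<M>"
      by (intro measurable_restrict_space1 measurable_completion) simp
    have "(\<lambda>(x, y). F x y) \<in> borel_measurable (borel \<Otimes>\<^sub>M borel)"
      unfolding borel_prod by (rule borel_measurable_continuous_onI[OF F_cont])
    then have "(\<lambda>x. (\<lambda>(x, y). F x y) (x, u x)) \<in> borel_measurable \<M>"
      by (rule measurable_compose[OF measurable_Pair[OF id that]])
    then show ?thesis by simp
  qed
  show "(\<lambda>x. F x (stair_sum D g x)) \<in> borel_measurable \<M>" by (rule Fm[OF stair_sum_measurable])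
  show "(\<lambda>x. F x (\<Sum>M<N. g M x)) \<in> borel_measurable \<M>" for N by (rule Fm[OF partial_sum_measurable])
  show "integrable \<M> (\<lambda>x. B * dominator L 1 x)"
    using assms(1) by (intro integrable_mult_right dominator_integrable L_nonneg) auto
  show "AE x in \<M>. (\<lambda>N. F x (\<Sum>M<N. g M x)) \<longlonglongrightarrow> F x (stair_sum D g x)"
    using partial_sum_tendsto
  proof eventually_elim
    case (elim x)
    have "continuous_on UNIV (F x)"
      using continuous_on_compose2[OF F_cont, of UNIV "\<lambda>y. (x, y)"]
      by (simp add: continuous_on_Pair)
    then have "isCont (F x) (stair_sum D g x)" by (simp add: continuous_on_eq_continuous_at)
    then show ?case using elim by (rule isCont_tendsto_compose)
  qed
  show "AE x in \<M>. norm (F x (\<Sum>M<N. g M x)) \<le> B * dominator L 1 x" for N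
    using partial_sum_bound[OF zero_le_one, of N]
  proof eventually_elim
    case (elim x)
    then have "B * norm (\<Sum>M<N. g M x) \<le> B * dominator L 1 x"
      by (intro mult_left_mono F(2)) simp
    then show ?case using F(1)[of x "\<Sum>M<N. g M x"] by simp
  qed
qed

end

section \<open>The limit as a Sobolev function\<close>

lemma locally_integrable_onI:
  fixes u :: "'a::euclidean_space \<Rightarrow> 'b::euclidean_space"
  assumes "\<Omega> \<in> sets lebesgue" "integrable (lebesgue_on \<Omega>) u"
  shows "locally_integrable_on u \<Omega>"
  unfolding locally_integrable_on_def
proof (intro allI impI)
  fix K assume K: "compact K \<and> K \<subseteq> \<Omega>"
  then have KS: "K \<in> sets lebesgue" by (simp add: fmeasurableD lmeasurable_compact)
  have sets: "S \<inter> space lebesgue \<in> sets lebesgue" if "S \<in> sets lebesgue" for S :: "'a set"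
    using that by simp
  have "set_integrable lebesgue \<Omega> u"
    using assms(2) unfolding set_integrable_def integrable_restrict_space[OF sets[OF assms(1)]] .
  then have "set_integrable lebesgue K u" by (rule set_integrable_subset) (use KS K in auto)
  then show "integrable (lebesgue_on K) u"
    unfolding set_integrable_def integrable_restrict_space[OF sets[OF KS]] .
qed

text \<open>The partial sums are test functions, for which integration by parts holds, and both
  sides pass to the limit; this uses exponent 1, which is below \<open>r\<close> because
  \<open>1 \<le> p < r\<close>. Domination with exponent \<open>p\<close> gives convergence of the
  values and the gradients.\<close>

lemma stair_sum_sobolev0:
  fixes \<phi> :: "nat \<Rightarrow> real^'n \<Rightarrow> real^'m"
  assumes "shrinking_sets D r" "1 \<le> p" "p < real r"
    and \<phi>: "\<And>N. \<phi> N \<in> test_functions (D N)"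
    and b: "\<And>N x. norm (\<phi> N x) \<le> 2 ^ N * L" "\<And>N x. norm (jacobian (\<phi> N) (at x)) \<le> 2 ^ N * L"
  defines "u \<equiv> stair_sum D \<phi>" and "G \<equiv> stair_sum D (\<lambda>N x. jacobian (\<phi> N) (at x))"
  shows "u \<in> sobolev0 p (D 0)" and "has_weak_gradient u G (D 0)"
proof -
  interpret shrinking_sets D r by fact
  interpret u: stair_functions D r \<phi> L
    by unfold_locales
      (rule test_function_continuous[OF \<phi>] test_function_zero_outside(1)[OF \<phi>] b | assumption)+
  interpret G: stair_functions D r "\<lambda>N x. jacobian (\<phi> N) (at x)" L
    by unfold_locales
      (rule continuous_on_jacobian[OF \<phi>] jacobian_zero_outside[OF \<phi>] b | assumption)+
  have r1: "1 < r" using assms by linarith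
  have \<phi>0: "\<phi> N \<in> test_functions (D 0)" for N
    using \<phi> test_functions_mono[OF D_subset] by blast
  have S: "(\<lambda>x. \<Sum>M<N. \<phi> M x) \<in> test_functions (D 0)" for N
    by (rule test_functions_sum) (rule \<phi>0)
  have JS: "jacobian (\<lambda>x. \<Sum>M<N. \<phi> M x) (at x) = (\<Sum>M<N. jacobian (\<phi> M) (at x))" for N x
    by (rule jacobian_sum) (rule \<phi>0)
  have D0: "D 0 \<in> sets lebesgue" using D0_sets by simp
  show wg: "has_weak_gradient u G (D 0)"
    unfolding has_weak_gradient_def
  proof (intro conjI ballI allI)
    show "locally_integrable_on u (D 0)"
      unfolding u_def by (rule locally_integrable_onI[OF D0 u.stair_sum_integrable[OF r1]])
    show "locally_integrable_on G (D 0)"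
      unfolding G_def by (rule locally_integrable_onI[OF D0 G.stair_sum_integrable[OF r1]])
    fix \<psi> :: "real^'n \<Rightarrow> real" and i :: 'm and j :: 'n
    assume \<psi>: "\<psi> \<in> test_functions (D 0)"
    let ?d = "\<lambda>x. frechet_derivative \<psi> (at x) (axis j 1)"
    obtain B where B: "\<And>x. norm (?d x) \<le> B"
      using test_function_bounded[OF test_functions_derivative[OF \<psi>, of "axis j 1"]] by metis
    obtain C where C: "\<And>x. norm (\<psi> x) \<le> C" using test_function_bounded[OF \<psi>] by metis
    have "B \<ge> 0" "C \<ge> 0" using B C norm_ge_zero order_trans by blast+
    have 1: "(\<lambda>N. \<integral>x. (\<Sum>M<N. \<phi> M x) $ i * ?d x \<partial>lebesgue_on (D 0))
        \<longlonglongrightarrow> (\<integral>x. u x $ i * ?d x \<partial>lebesgue_on (D 0))"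
      unfolding u_def
    proof (rule u.stair_sum_integral_limit[OF r1, where B = B])
      show "\<bar>y $ i * ?d x\<bar> \<le> B * norm y" for x and y :: "real^'m"
        using mult_mono[OF component_le_norm_cart[of y i] B[of x]] by (simp add: abs_mult mult.commute)
      show "continuous_on UNIV (\<lambda>(x, y :: real^'m). y $ i * ?d x)"
        unfolding case_prod_beta
        by (intro continuous_intros continuous_on_compose2[OF test_function_continuous[OF test_functions_derivative[OF \<psi>]]]) auto
    qed (rule \<open>B \<ge> 0\<close>)
    have 2: "(\<lambda>N. \<integral>x. (\<Sum>M<N. jacobian (\<phi> M) (at x)) $ i $ j * \<psi> x \<partial>lebesgue_on (D 0))
        \<longlonglongrightarrow> (\<integral>x. G x $ i $ j * \<psi> x \<partial>lebesgue_on (D 0))"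
      unfolding G_def
    proof (rule G.stair_sum_integral_limit[OF r1, where B = C])
      show "\<bar>y $ i $ j * \<psi> x\<bar> \<le> C * norm y" for x and y :: "real^'n^'m"
      proof -
        have "\<bar>y $ i $ j\<bar> \<le> norm y"
          using component_le_norm_cart[of "y $ i" j] Finite_Cartesian_Product.norm_nth_le[of y i] by simp
        then show ?thesis using mult_mono[OF _ C[of x], of "\<bar>y $ i $ j\<bar>" "norm y"] by (simp add: abs_mult mult.commute)
      qed
      show "continuous_on UNIV (\<lambda>(x, y :: real^'n^'m). y $ i $ j * \<psi> x)"
        unfolding case_prod_beta
        by (intro continuous_intros continuous_on_compose2[OF test_function_continuous[OF \<psi>]]) auto
    qed (rule \<open>C \<ge> 0\<close>)
    have "(\<integral>x. (\<Sum>M<N. \<phi> M x) $ i * ?d x \<partial>lebesgue_on (D 0))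
        = - (\<integral>x. (\<Sum>M<N. jacobian (\<phi> M) (at x)) $ i $ j * \<psi> x \<partial>lebesgue_on (D 0))" for N
      using integration_by_parts_test_functions[OF D_open S[of N] \<psi>, of i j] by (simp only: JS)
    then show "(\<integral>x. u x $ i * ?d x \<partial>lebesgue_on (D 0)) = - (\<integral>x. G x $ i $ j * \<psi> x \<partial>lebesgue_on (D 0))"
      using LIMSEQ_unique[OF 1] tendsto_minus[OF 2] by simp
  qed
  have "u \<in> Lp_space p (D 0)" "G \<in> Lp_space p (D 0)"
    using assms(2,3) unfolding Lp_space_def u_def G_def
    by (auto intro: u.stair_sum_measurable G.stair_sum_measurable u.stair_sum_powr_integrable G.stair_sum_powr_integrable)
  moreover have "(\<lambda>N. \<integral>x. norm ((\<Sum>M<N. \<phi> M x) - u x) powr p \<partial>lebesgue_on (D 0)) \<longlonglongrightarrow> 0"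
    unfolding u_def using assms(2,3) by (intro u.stair_sum_Lp_limit) auto
  moreover have "(\<lambda>N. \<integral>x. norm (jacobian (\<lambda>x. \<Sum>M<N. \<phi> M x) (at x) - G x) powr p \<partial>lebesgue_on (D 0)) \<longlonglongrightarrow> 0"
    unfolding G_def JS using assms(2,3) by (intro G.stair_sum_Lp_limit) auto
  ultimately show "u \<in> sobolev0 p (D 0)"
    unfolding sobolev0_def using wg S
    by (intro CollectI exI[of _ G] exI[of _ "\<lambda>N x. \<Sum>M<N. \<phi> M x"] conjI allI)
qed

section \<open>Induction on the rank\<close>

text \<open>A basis of the row space serves as its own index set, and \<open>c b\<close> collects
  the coordinates of all rows along \<open>b\<close>.\<close>

lemma outer_decomposition:
  fixes A :: "real^'n^'m"
  obtains B :: "(real^'n) set" and c where "finite B" "card B = rank A" "0 \<notin> B"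
    "A = (\<Sum>b\<in>B. outer (c b) b)"
proof -
  obtain B where B: "B \<subseteq> rows A" "independent B" "rows A \<subseteq> span B" "card B = dim (rows A)"
    using basis_exists[of "rows A"] by blast
  have fin: "finite B" using B(2) by (rule independent_imp_finite)
  have "\<exists>u. (\<Sum>b\<in>B. u b *\<^sub>R b) = A $ i" for i
  proof -
    have "A $ i \<in> rows A" by (auto simp: rows_def row_def)
    then have "A $ i \<in> span B" using B by blast
    then show ?thesis unfolding span_finite[OF fin] by auto
  qed
  then obtain u where u: "\<And>i. (\<Sum>b\<in>B. u i b *\<^sub>R b) = A $ i" by metis
  show ?thesis
  proof (rule that[of B "\<lambda>b. \<chi> i. u i b"])
    show "A = (\<Sum>b\<in>B. outer (\<chi> i. u i b) b)"
      by (subst vec_eq_iff) (simp add: outer_def u)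
    show "0 \<notin> B" using B(2) dependent_zero by blast
    show "card B = rank A" using B(4) by (simp add: row_rank_def)
  qed (rule fin)
qed

text \<open>All rows lie in the span of the vectors other than the one whose coefficient
  vanishes.\<close>

lemma rank_outer_sum_le:
  fixes c :: "real^'n \<Rightarrow> real^'m"
  assumes "finite B" "\<exists>b\<in>B. t b = 0"
  shows "rank (\<Sum>b\<in>B. t b *\<^sub>R outer (c b) b) \<le> card B - 1"
proof -
  obtain d where d: "d \<in> B" "t d = 0" using assms by blast
  have "rows (\<Sum>b\<in>B. t b *\<^sub>R outer (c b) b) \<subseteq> span (B - {d})"
  proof
    fix v assume "v \<in> rows (\<Sum>b\<in>B. t b *\<^sub>R outer (c b) b)"
    moreover have "row i A = A $ i" for i and A :: "real^'n^'m" by (simp add: row_def vec_eq_iff)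
    ultimately obtain i where "v = (\<Sum>b\<in>B. t b *\<^sub>R outer (c b) b) $ i"
      unfolding rows_def by auto
    then have v: "v = (\<Sum>b\<in>B. (t b * c b $ i) *\<^sub>R b)" by (simp add: outer_def)
    show "v \<in> span (B - {d})"
      unfolding v
    proof (rule span_sum)
      show "(t b * c b $ i) *\<^sub>R b \<in> span (B - {d})" if "b \<in> B" for b
        using that d by (cases "b = d") (auto intro: span_scale span_base span_zero)
    qed
  qed
  then have "dim (rows (\<Sum>b\<in>B. t b *\<^sub>R outer (c b) b)) \<le> card (B - {d})"
    using assms(1) by (intro dim_le_card) auto
  then show ?thesis using d by (simp add: row_rank_def)
qed

section \<open>Quasiconvexity tested with the staircase\<close>

text \<open>Because \<open>p\<close> is below the rank, the limit of the staircase is an admissible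
  competitor. Its energy is at most \<open>\<gamma> + e\<close> times the measure of the domain,
  with \<open>e\<close> arbitrarily small.\<close>

lemma quasiconvex_rank_step:
  fixes f :: "real^'n^'m \<Rightarrow> real" and \<xi> :: "real^'n^'m"
  assumes "1 \<le> p" "p < real (rank \<xi>)" "continuous_on UNIV f" "0 \<le> \<gamma>"
    and qc: "W1p_quasiconvex_at p (\<lambda>\<xi>. ereal (f \<xi>)) \<xi>"
    and low: "\<And>\<eta>. rank \<eta> \<le> rank \<xi> - 1 \<Longrightarrow> f \<eta> \<le> \<gamma>"
  shows "f \<xi> \<le> \<gamma>"
proof (rule field_le_epsilon)
  fix e :: real assume e: "e > 0"
  obtain \<Omega> where \<Omega>: "\<Omega> \<noteq> {}" "bounded \<Omega>" "open \<Omega>"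
    and qc\<Omega>: "\<And>\<phi> G. \<phi> \<in> sobolev0 p \<Omega> \<Longrightarrow> has_weak_gradient \<phi> G \<Omega> \<Longrightarrow>
      ereal (measure lebesgue \<Omega>) * ereal (f \<xi>) \<le> extended_integral (lebesgue_on \<Omega>) (\<lambda>x. ereal (f (\<xi> + G x)))"
    using qc unfolding W1p_quasiconvex_at_def by blast
  define m where "m = measure lebesgue \<Omega>"
  have \<Omega>m: "\<Omega> \<in> lmeasurable" using \<Omega> by (intro lmeasurable_open)
  have m: "m > 0"
  proof -
    have "\<not> negligible \<Omega>" using \<Omega> open_not_negligible by blast
    then show ?thesis
      using \<Omega>m by (simp add: m_def negligible_iff_measure zero_less_measure_iff)
  qed
  obtain B c where B: "finite B" "card B = rank \<xi>" "0 \<notin> B" "\<xi> = (\<Sum>b\<in>B. outer (c b) b)"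
    using outer_decomposition[of \<xi>] by blast
  have low': "f (\<Sum>b\<in>B. t b *\<^sub>R outer (c b) b) \<le> \<gamma>" if "\<exists>b\<in>B. t b = 0" for t
    using low rank_outer_sum_le[OF B(1) that, of c] B(2) by simp
  define L where "L = (\<Sum>b\<in>B. norm (outer (c b) b) + 1)"
  \<comment> \<open>In place of a growth condition, compactness of closed balls gives a bound for
    \<open>f\<close> that depends on the radius.\<close>
  have "\<exists>K>0. \<forall>\<eta>. norm \<eta> \<le> R \<longrightarrow> f \<eta> \<le> K" for R
  proof -
    have "compact (f ` cball 0 R)"
      by (intro compact_continuous_image continuous_on_subset[OF assms(3)]) auto
    from compact_imp_bounded[OF this] obtain K where "K > 0" "\<And>y. y \<in> f ` cball 0 R \<Longrightarrow> norm y \<le> K"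
      unfolding bounded_pos by blast
    then show ?thesis by (intro exI[of _ K]) force
  qed
  then obtain K where K: "\<And>R. K R > 0" "\<And>R \<eta>. norm \<eta> \<le> R \<Longrightarrow> f \<eta> \<le> K R" by metis
  \<comment> \<open>Where round \<open>N\<close> is the last to act, the norm of
    \<open>\<xi> + G x\<close> is at most this radius, so \<open>M N\<close> bounds \<open>f\<close>
    there.\<close>
  define M where "M N = K (2 ^ N * (norm \<xi> + L))" for N :: nat
  have M: "M N > 0" for N by (simp add: M_def K)
  \<comment> \<open>Fixed before the exceptional sets are built: the products
    \<open>M N * \<epsilon> N\<close> then add up to \<open>e * m\<close>.\<close>
  define \<epsilon> where "\<epsilon> N = e * m * (1/2) ^ Suc N / M N" for N
  have \<epsilon>: "\<epsilon> N > 0" for N using e m M by (simp add: \<epsilon>_def)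
  have nz: "b \<noteq> 0" if "b \<in> B" for b using B(3) that by auto
  obtain \<phi> :: "nat \<Rightarrow> real^'n \<Rightarrow> real^'m" and D E where D:
    "D 0 = \<Omega>" "\<And>N. open (D N)" "\<And>N. D (Suc N) \<subseteq> D N"
    "\<And>N. measure lebesgue (D N) \<le> measure lebesgue \<Omega> / 2 ^ (card B * N)"
    "\<And>N. \<phi> N \<in> test_functions (D N)" "\<And>N. E N \<in> lmeasurable" "\<And>N. measure lebesgue (E N) \<le> \<epsilon> N"
    "\<And>N x. x \<in> D (Suc N) \<Longrightarrow> jacobian (\<phi> N) (at x) = 2 ^ N *\<^sub>R \<xi>"
    "\<And>N x. x \<in> D N - D (Suc N) - E N \<Longrightarrow> f (2 ^ N *\<^sub>R \<xi> + jacobian (\<phi> N) (at x)) \<le> \<gamma>"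
    "\<And>N x. norm (jacobian (\<phi> N) (at x)) \<le> 2 ^ N * L" "\<And>N x. norm (\<phi> N x) \<le> 2 ^ N * L"
    by (rule staircase[of B "\<lambda>b. b" \<Omega> f c \<gamma> \<xi> L \<epsilon>, OF B(1) nz \<Omega>(3,2) low' B(4) L_def \<epsilon>])
      (assumption | (rule that; assumption))+
  define r where "r = card B"
  have r: "p < real r" using assms(2) B(2) by (simp add: r_def)
  have shr: "shrinking_sets D r"
    by unfold_locales (use D \<Omega> r assms(1) in \<open>auto simp: r_def[symmetric]\<close>)
  then interpret shrinking_sets D r .
  define u where "u = stair_sum D \<phi>"
  define G where "G = stair_sum D (\<lambda>N x. jacobian (\<phi> N) (at x))"
  have uG: "u \<in> sobolev0 p \<Omega>" "has_weak_gradient u G \<Omega>"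
    using stair_sum_sobolev0[OF shr assms(1) r D(5) D(11,10)] unfolding D(1) u_def G_def by blast+
  \<comment> \<open>The majorant is \<open>\<gamma>\<close> on the whole domain plus the crude bound
    \<open>M n\<close> on the \<open>n\<close>-th exceptional set.\<close>
  let ?h = "\<lambda>x. ennreal \<gamma> * indicator \<Omega> x + (\<Sum>n. ennreal (M n) * indicator (E n) x)"
  have pw: "e2ennreal (ereal (f (\<xi> + G x))) \<le> ?h x"
    if x: "x \<in> \<Omega>" and lev: "\<forall>M. x \<in> D M \<longleftrightarrow> M < k" for x k
  proof -
    have "0 < k" using x lev D(1) by metis
    \<comment> \<open>The last round acting at \<open>x\<close> is \<open>n = k - 1\<close>. The
      earlier ones contribute a geometric sum of multiples of \<open>\<xi>\<close> and leave
      \<open>2 ^ n *\<^sub>R \<xi>\<close> as the starting matrix of round \<open>n\<close>.\<close>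
    then obtain n where n: "k = Suc n" by (cases k) auto
    have "(\<Sum>i<n. jacobian (\<phi> i) (at x)) = (\<Sum>i<n. 2 ^ i *\<^sub>R \<xi>)"
      by (intro sum.cong refl D(8)) (use lev n in auto)
    also have "\<dots> = (2 ^ n - 1) *\<^sub>R \<xi>"
    proof -
      have "(\<Sum>i<n. 2 ^ i :: real) = 2 ^ n - 1" by (induction n) simp_all
      then show ?thesis by (simp only: scaleR_sum_left[symmetric])
    qed
    finally have G: "\<xi> + G x = 2 ^ n *\<^sub>R \<xi> + jacobian (\<phi> n) (at x)"
      unfolding G_def stair_sum_level[OF lev] n by (simp add: algebra_simps)
    show ?thesis
    proof (cases "x \<in> E n")
      case False
      then have "f (\<xi> + G x) \<le> \<gamma>"
        unfolding G using lev n by (intro D(9)) auto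
      then have "e2ennreal (ereal (f (\<xi> + G x))) \<le> ennreal \<gamma>"
        by (simp add: ennreal.abs_eq[symmetric] e2ennreal_mono flip: e2ennreal_ereal)
      also have "\<dots> \<le> ?h x" using x by simp
      finally show ?thesis .
    next
      case True
      have "norm (\<xi> + G x) \<le> 2 ^ n * norm \<xi> + 2 ^ n * L"
        unfolding G by (rule norm_triangle_le) (use D(10)[of n x] in simp)
      then have "f (\<xi> + G x) \<le> M n" unfolding M_def by (intro K(2)) (simp add: distrib_left)
      then have "e2ennreal (ereal (f (\<xi> + G x))) \<le> ennreal (M n)"
        by (simp add: e2ennreal_mono flip: e2ennreal_ereal)
      also have "\<dots> = (\<Sum>i\<in>{n}. ennreal (M i) * indicator (E i) x)" using True by simp
      also have "\<dots> \<le> (\<Sum>i. ennreal (M i) * indicator (E i) x)"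
        by (rule sum_le_suminf) auto
      also have "\<dots> \<le> ?h x" by simp
      finally show ?thesis .
    qed
  qed
  have Es: "E n \<in> sets lebesgue" for n using D(6) by blast
  have "(\<integral>\<^sup>+x. e2ennreal (ereal (f (\<xi> + G x))) \<partial>lebesgue_on \<Omega>) \<le> (\<integral>\<^sup>+x. ?h x \<partial>lebesgue_on \<Omega>)"
  proof (rule nn_integral_mono_AE)
    have "AE x in lebesgue_on \<Omega>. x \<in> \<Omega>"
      by (rule AE_I2) (simp add: space_restrict_space)
    with AE_level[unfolded D(1)] show "AE x in lebesgue_on \<Omega>. e2ennreal (ereal (f (\<xi> + G x))) \<le> ?h x"
      by eventually_elim (use pw in blast)
  qed
  also have "\<dots> = (\<integral>\<^sup>+x. ?h x * indicator \<Omega> x \<partial>lebesgue)"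
    using \<Omega>m by (intro nn_integral_restrict_space) auto
  \<comment> \<open>Of the sets \<open>E n\<close> only measurability and measure are known, so the
    majorant is integrated over the whole space.\<close>
  also have "\<dots> \<le> (\<integral>\<^sup>+x. ?h x \<partial>lebesgue)"
    by (intro nn_integral_mono) (simp add: indicator_def)
  also have "\<dots> = ennreal \<gamma> * emeasure lebesgue \<Omega> + (\<Sum>n. ennreal (M n) * emeasure lebesgue (E n))"
  proof -
    have "(\<integral>\<^sup>+x. ?h x \<partial>lebesgue) = (\<integral>\<^sup>+x. ennreal \<gamma> * indicator \<Omega> x \<partial>lebesgue)
        + (\<integral>\<^sup>+x. (\<Sum>n. ennreal (M n) * indicator (E n) x) \<partial>lebesgue)"
      by (intro nn_integral_add borel_measurable_suminf_order borel_measurable_times_ennreal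
          borel_measurable_const borel_measurable_indicator Es fmeasurableD[OF \<Omega>m])
    also have "(\<integral>\<^sup>+x. (\<Sum>n. ennreal (M n) * indicator (E n) x) \<partial>lebesgue)
        = (\<Sum>n. \<integral>\<^sup>+x. ennreal (M n) * indicator (E n) x \<partial>lebesgue)"
      by (intro nn_integral_suminf borel_measurable_times_ennreal borel_measurable_const
          borel_measurable_indicator Es)
    finally show ?thesis using Es fmeasurableD[OF \<Omega>m] by (simp only: nn_integral_cmult_indicator)
  qed
  also have "\<dots> \<le> ennreal (\<gamma> * m) + (\<Sum>n. ennreal (e * m * (1/2) ^ Suc n))"
  proof (intro add_mono suminf_le)
    show "ennreal \<gamma> * emeasure lebesgue \<Omega> \<le> ennreal (\<gamma> * m)"
      unfolding emeasure_eq_measure2[OF \<Omega>m] using \<open>0 \<le> \<gamma>\<close> by (simp only: m_def ennreal_mult measure_nonneg)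
    show "ennreal (M n) * emeasure lebesgue (E n) \<le> ennreal (e * m * (1/2) ^ Suc n)" for n
    proof -
      have "M n * measure lebesgue (E n) \<le> M n * \<epsilon> n"
        using M[of n] D(7)[of n] by (intro mult_left_mono) auto
      also have "\<dots> = e * m * (1/2) ^ Suc n" using M[of n] by (simp add: \<epsilon>_def)
      finally show ?thesis
        unfolding emeasure_eq_measure2[OF D(6)] using M[of n]
        by (simp only: ennreal_mult[symmetric] measure_nonneg less_imp_le ennreal_leI)
    qed
  qed auto
  also have "(\<Sum>n. ennreal (e * m * (1/2) ^ Suc n)) = ennreal (e * m)"
  proof -
    have "(\<lambda>n. e * m * (1/2) ^ Suc n) sums (e * m * 1)"
      by (intro sums_mult power_half_series)
    then show ?thesis
      using e m by (intro sums_unique[symmetric]) (simp add: sums_ennreal)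
  qed
  also have "ennreal (\<gamma> * m) + ennreal (e * m) = ennreal (\<gamma> * m + e * m)"
    using e m \<open>0 \<le> \<gamma>\<close> by (simp add: ennreal_plus)
  finally have upper: "(\<integral>\<^sup>+x. e2ennreal (ereal (f (\<xi> + G x))) \<partial>lebesgue_on \<Omega>) \<le> ennreal (\<gamma> * m + e * m)" .
  have "ereal m * ereal (f \<xi>) \<le> extended_integral (lebesgue_on \<Omega>) (\<lambda>x. ereal (f (\<xi> + G x)))"
    unfolding m_def by (rule qc\<Omega>[OF uG])
  \<comment> \<open>Dropping the integral of the negative part can only increase the value.\<close>
  also have "\<dots> \<le> enn2ereal (\<integral>\<^sup>+x. e2ennreal (ereal (f (\<xi> + G x))) \<partial>lebesgue_on \<Omega>)"
    unfolding extended_integral_def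
    by (rule order_trans[OF ereal_minus_mono[OF order_refl enn2ereal_nonneg]]) simp
  also have "\<dots> \<le> enn2ereal (ennreal (\<gamma> * m + e * m))"
    using upper by (simp only: less_eq_ennreal.rep_eq)
  also have "\<dots> = ereal (\<gamma> * m + e * m)"
    using e m \<open>0 \<le> \<gamma>\<close> by (intro enn2ereal_ennreal) simp
  finally have "m * f \<xi> \<le> m * (\<gamma> + e)" by (simp add: algebra_simps)
  then show "f \<xi> \<le> \<gamma> + e" using m by simp
qed

theorem corollary1p7:
  fixes f :: "real^'n^'m \<Rightarrow> real" and p :: real and k :: nat
  assumes "2 \<le> CARD('n)" and "2 \<le> CARD('m)"
    and "2 \<le> k" and "k \<le> min CARD('n) CARD('m)"
    and "1 \<le> p" and "p < real k"
    and "continuous_on UNIV f"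
    and "bdd_below (range f)"
    and "W1p_quasiconvex p (\<lambda>\<xi>. ereal (f \<xi>))"
  shows "(\<forall>\<gamma>\<ge>0. (\<forall>\<xi>. rank \<xi> \<le> k - 1 \<longrightarrow> f \<xi> \<le> \<gamma>) \<longrightarrow> (\<forall>\<xi>. f \<xi> \<le> \<gamma>)) \<and>
    ((\<forall>\<xi>. 0 \<le> f \<xi>) \<and> (\<forall>\<xi>. rank \<xi> \<le> k - 1 \<longrightarrow> f \<xi> = 0) \<longrightarrow> (\<forall>\<xi>. f \<xi> = 0))"
proof -
  \<comment> \<open>Strong induction on the rank. Up to rank \<open>k - 1\<close> the bound is
    assumed; a larger rank is at least \<open>k\<close>, hence above \<open>p\<close>, and all
    smaller ranks are already settled.\<close>
  have main: "f \<xi> \<le> \<gamma>" if "0 \<le> \<gamma>" and low: "\<And>\<xi>. rank \<xi> \<le> k - 1 \<Longrightarrow> f \<xi> \<le> \<gamma>" for \<gamma> \<xi>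
  proof (induction "rank \<xi>" arbitrary: \<xi> rule: less_induct)
    case less
    show ?case
    proof (cases "rank \<xi> \<le> k - 1")
      case False
      then show ?thesis
        using assms(3,5,6,7,9) \<open>0 \<le> \<gamma>\<close> unfolding W1p_quasiconvex_def
        by (intro quasiconvex_rank_step[of p \<xi> f] less) auto
    qed (rule low)
  qed
  \<comment> \<open>The second claim is the case \<open>\<gamma> = 0\<close>, with non-negativity as
    the reverse inequality.\<close>
  show ?thesis
    by (auto intro: main intro!: antisym[OF main])
qed

end
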